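(* Let $A$ be an infinite abelian group of finite exponent, viewed as a structure in the language $\mathcal L=\{0,+\}$. For each prime $p$ let $n_p:=|U_{\ge\aleph_0}(p;A)|$, and let $m_p:=\max U_{\ge\aleph_0}(p;A)$ if $U_{\ge\aleph_0}(p;A)\neq\emptyset$ and $m_p:=0$ otherwise. Set $d:=\sum_p\min\{n_p,\lfloor m_p/2\rfloor+1\}$. Then every $\mathcal L$-formula $\varphi(x;y)$ has VC density at most $d\,|y|$ in $A$.
   Context: For an abelian group $A$, a prime $p$ and $i\ge 0$, the Ulm invariant is $U(p,i;A):=|(p^iA)[p]/(p^{i+1}A)[p]|$, where $(p^iA)[p]=\{a\in A: pa=0 \text{ and } a=p^ib \text{ for some } b\in A\}$. $U_{\ge\aleph_0}(p;A)$ is the set of $i\ge 0$ with $U(p,i;A)$ infinite. For a partitioned formula $\varphi(x;y)$, the shatter function $\pi_\varphi(t)$ is the maximum, over $t$-element subsets $S\subseteq A^{|x|}$, of the number of sets of the form $S\cap\varphi(A^{|x|};b)$, $b\in A^{|y|}$; the VC density of $\varphi$ is $\inf\{r\ge0:\pi_\varphi(t)=O(t^r)\}$ (and $\infty$ if $\pi_\varphi(t)=2^t$ for all $t$). *)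

theory Defs
  imports "HOL-Analysis.Analysis" "HOL-Library.Landau_Symbols"
    "HOL-Computational_Algebra.Primes"
begin

section \<open>Ulm invariants of an abelian group\<close>

text \<open>The abelian group is a type of class \<^class>\<open>ab_group_add\<close>; invariants of the group
  that do not mention its elements take a type token \<open>TYPE('a)\<close>.\<close>

primrec nmul :: "nat \<Rightarrow> 'a::ab_group_add \<Rightarrow> 'a" where
  "nmul 0 a = 0"
| "nmul (Suc n) a = a + nmul n a"

definition finite_exponent :: "'a::ab_group_add itself \<Rightarrow> bool" where
  "finite_exponent _ \<longleftrightarrow> (\<exists>N>0. \<forall>a::'a. nmul N a = 0)"

text \<open>\<open>divisible_torsion p i\<close> is the subgroup \<open>(p\<^sup>iA)[p]\<close>.\<close>

definition divisible_torsion :: "nat \<Rightarrow> nat \<Rightarrow> 'a::ab_group_add set" where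
  "divisible_torsion p i = {a. nmul p a = 0 \<and> (\<exists>b. a = nmul (p ^ i) b)}"

text \<open>The set of cosets \<open>(p\<^sup>iA)[p] / (p\<^bsup>i+1\<^esup>A)[p]\<close>, whose cardinality is the Ulm
  invariant \<open>U(p,i;A)\<close>.\<close>

definition ulm_quotient :: "nat \<Rightarrow> nat \<Rightarrow> 'a::ab_group_add set set" where
  "ulm_quotient p i = (\<lambda>a. (+) a ` divisible_torsion p (Suc i)) ` divisible_torsion p i"

definition ulm_inf :: "'a::ab_group_add itself \<Rightarrow> nat \<Rightarrow> nat set" where
  "ulm_inf _ p = {i. infinite (ulm_quotient p i :: 'a set set)}"

definition ulm_n :: "'a::ab_group_add itself \<Rightarrow> nat \<Rightarrow> nat" where
  "ulm_n A p = card (ulm_inf A p)"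

definition ulm_m :: "'a::ab_group_add itself \<Rightarrow> nat \<Rightarrow> nat" where
  "ulm_m A p = (if ulm_inf A p \<noteq> {} then Max (ulm_inf A p) else 0)"

text \<open>Primes with \<open>ulm_inf A p = {}\<close> have \<open>n\<^sub>p = 0\<close> and contribute nothing to the sum over all
  primes. For groups of finite exponent only finitely many primes remain, and each
  \<open>ulm_inf A p\<close> is finite; see \<open>finite_ulm_inf\<close> and \<open>finite_ulm_primes\<close> below.\<close>

definition ulm_d :: "'a::ab_group_add itself \<Rightarrow> nat" where
  "ulm_d A = (\<Sum>p | prime p \<and> ulm_inf A p \<noteq> {}. min (ulm_n A p) (ulm_m A p div 2 + 1))"

lemma nmul_zero_right [simp]: "nmul n 0 = 0"
  by (induction n) auto

lemma nmul_add_left: "nmul (m + n) a = nmul m a + nmul n a"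
  by (induction m) (auto simp: add.assoc)

lemma nmul_mult: "nmul (m * n) a = nmul m (nmul n a)"
  by (induction m) (auto simp: nmul_add_left)

lemma nmul_gcd_eq_0: "nmul m a = 0 \<Longrightarrow> nmul n a = 0 \<Longrightarrow> nmul (gcd m n) a = 0"
proof (induction m n rule: gcd_nat_induct)
  case (step m n)
  have "nmul ((m div n) * n + m mod n) a = 0"
    using step.prems(1) by simp
  then have "nmul (m mod n) a = 0"
    using step.prems(2) by (simp only: nmul_add_left nmul_mult nmul_zero_right add_0)
  with step.IH step.prems(2) have "nmul (gcd n (m mod n)) a = 0"
    by blast
  then show ?case
    by (subst gcd_red_nat)
qed auto

lemma ulm_inf_dvd:
  assumes "prime p" and N: "\<forall>a::'a::ab_group_add. nmul N a = 0"
    and "i \<in> ulm_inf TYPE('a) p"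
  shows "p ^ Suc i dvd N"
proof -
  have "infinite (divisible_torsion p i :: 'a set)"
    using assms(3) unfolding ulm_inf_def ulm_quotient_def by auto
  then have "\<not> (divisible_torsion p i :: 'a set) \<subseteq> {0}"
    using finite_subset by blast
  then obtain b :: 'a where b: "nmul p (nmul (p ^ i) b) = 0" "nmul (p ^ i) b \<noteq> 0"
    unfolding divisible_torsion_def by auto
  then have "nmul (p ^ Suc i) b = 0"
    by (simp add: nmul_mult)
  then have g: "nmul (gcd (p ^ Suc i) N) b = 0"
    using N nmul_gcd_eq_0 by blast
  obtain j where j: "j \<le> Suc i" "gcd (p ^ Suc i) N = p ^ j"
    using divides_primepow_nat[OF assms(1), of "gcd (p ^ Suc i) N" "Suc i"] by auto
  have "j = Suc i"
  proof (rule ccontr)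
    assume "j \<noteq> Suc i"
    then have "p ^ i = p ^ (i - j) * p ^ j"
      using j(1) by (simp flip: power_add)
    then show False
      using b(2) g j(2) by (simp add: nmul_mult)
  qed
  then show ?thesis
    using j(2) by (metis gcd_dvd2)
qed

lemma finite_ulm_inf:
  assumes "finite_exponent TYPE('a::ab_group_add)" and "prime p"
  shows "finite (ulm_inf TYPE('a) p)"
proof -
  obtain N where N: "N > 0" "\<forall>a::'a. nmul N a = 0"
    using assms(1) unfolding finite_exponent_def by blast
  have "i < N" if "i \<in> ulm_inf TYPE('a) p" for i
  proof -
    have "p ^ Suc i \<le> N"
      using ulm_inf_dvd[OF assms(2) N(2) that] N(1) dvd_imp_le by blast
    moreover have "Suc i < p ^ Suc i"
      by (rule power_gt_expt) (use prime_ge_2_nat[OF assms(2)] in simp)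
    ultimately show ?thesis by linarith
  qed
  then show ?thesis
    by (meson finite_nat_set_iff_bounded)
qed

lemma finite_ulm_primes:
  assumes "finite_exponent TYPE('a::ab_group_add)"
  shows "finite {p. prime p \<and> ulm_inf TYPE('a) p \<noteq> {}}"
proof -
  obtain N where N: "N > 0" "\<forall>a::'a. nmul N a = 0"
    using assms unfolding finite_exponent_def by blast
  have "p dvd N" if "prime p" "ulm_inf TYPE('a) p \<noteq> {}" for p
    using ulm_inf_dvd[OF that(1) N(2)] that(2) by (auto dest: dvd_mult_left)
  then have "{p. prime p \<and> ulm_inf TYPE('a) p \<noteq> {}} \<subseteq> {p. p dvd N}"
    by auto
  then show ?thesis
    using N(1) finite_divisors_nat[of N] by (rule_tac finite_subset) auto
qed


section \<open>First-order formulas in the language {0, +}\<close>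

datatype trm = Var nat | Zero | Plus trm trm

text \<open>The remaining connectives and the universal quantifier are the usual abbreviations.\<close>

datatype fm = Eql trm trm | Neg fm | Conj fm fm | Exi nat fm

primrec tval :: "(nat \<Rightarrow> 'a::ab_group_add) \<Rightarrow> trm \<Rightarrow> 'a" where
  "tval e (Var v) = e v"
| "tval e Zero = 0"
| "tval e (Plus s t) = tval e s + tval e t"

primrec sat :: "(nat \<Rightarrow> 'a::ab_group_add) \<Rightarrow> fm \<Rightarrow> bool" where
  "sat e (Eql s t) \<longleftrightarrow> tval e s = tval e t"
| "sat e (Neg f) \<longleftrightarrow> \<not> sat e f"
| "sat e (Conj f g) \<longleftrightarrow> sat e f \<and> sat e g"
| "sat e (Exi v f) \<longleftrightarrow> (\<exists>a. sat (e(v := a)) f)"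

primrec vars_trm :: "trm \<Rightarrow> nat set" where
  "vars_trm (Var v) = {v}"
| "vars_trm Zero = {}"
| "vars_trm (Plus s t) = vars_trm s \<union> vars_trm t"

primrec free_vars :: "fm \<Rightarrow> nat set" where
  "free_vars (Eql s t) = vars_trm s \<union> vars_trm t"
| "free_vars (Neg f) = free_vars f"
| "free_vars (Conj f g) = free_vars f \<union> free_vars g"
| "free_vars (Exi v f) = free_vars f - {v}"

text \<open>\<open>\<phi>(x;y)\<close>: the tuples \<open>x\<close> and \<open>y\<close> consist of pairwise distinct variables and
  contain all free variables of \<open>\<phi>\<close>.\<close>

definition partitioned :: "fm \<Rightarrow> nat list \<Rightarrow> nat list \<Rightarrow> bool" where
  "partitioned \<phi> x y \<longleftrightarrow> distinct (x @ y) \<and> free_vars \<phi> \<subseteq> set x \<union> set y"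

text \<open>The value \<open>0\<close> outside of \<open>vs\<close> is irrelevant for formulas with free variables in \<open>vs\<close>.\<close>

definition assign :: "nat list \<Rightarrow> 'a::ab_group_add list \<Rightarrow> nat \<Rightarrow> 'a" where
  "assign vs as v = (case map_of (zip vs as) v of Some a \<Rightarrow> a | None \<Rightarrow> 0)"

definition tuples :: "nat \<Rightarrow> 'a list set" where
  "tuples n = {as. length as = n}"

definition instance_set ::
    "fm \<Rightarrow> nat list \<Rightarrow> nat list \<Rightarrow> 'a::ab_group_add list \<Rightarrow> 'a list set" where
  "instance_set \<phi> x y b = {a \<in> tuples (length x). sat (assign (x @ y) (a @ b)) \<phi>}"


section \<open>VC density\<close>

definition traces ::
    "fm \<Rightarrow> nat list \<Rightarrow> nat list \<Rightarrow> 'a::ab_group_add list set \<Rightarrow> 'a list set set" where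
  "traces \<phi> x y S = (\<lambda>b. S \<inter> instance_set \<phi> x y b) ` tuples (length y)"

text \<open>The supremum is a maximum (all the numbers are at most \<open>2\<^sup>t\<close>) except when \<open>x\<close> is the empty
  tuple and \<open>t > 1\<close>: then there are no \<open>t\<close>-element sets, and its value is \<open>0\<close>.\<close>

definition shatter :: "'a::ab_group_add itself \<Rightarrow> fm \<Rightarrow> nat list \<Rightarrow> nat list \<Rightarrow> nat \<Rightarrow> nat" where
  "shatter _ \<phi> x y t =
     (SUP S\<in>{S :: 'a list set. S \<subseteq> tuples (length x) \<and> finite S \<and> card S = t}.
        card (traces \<phi> x y S))"

lemma card_traces_le: "finite S \<Longrightarrow> card (traces \<phi> x y S) \<le> 2 ^ card S"
  using card_mono[of "Pow S" "traces \<phi> x y S"] by (auto simp: traces_def card_Pow)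

definition vc_density ::
    "'a::ab_group_add itself \<Rightarrow> fm \<Rightarrow> nat list \<Rightarrow> nat list \<Rightarrow> ereal" where
  "vc_density A \<phi> x y =
     (if \<forall>t. shatter A \<phi> x y t = 2 ^ t then \<infinity>
      else (INF r\<in>{r::real. 0 \<le> r \<and>
              (\<lambda>t. real (shatter A \<phi> x y t)) \<in> O(\<lambda>t. real t powr r)}. ereal r))"

end

theory Submission
  imports Defs "HOL-Library.Function_Algebras" "HOL-Real_Asymp.Real_Asymp"
begin

text \<open>Call a subgroup of a power of \<open>A\<close> invariant if it is stable under all partial homomorphisms
  \<open>A \<rightharpoonup> A\<close> that do not decrease heights. In a group of finite exponent such partial maps extend,
  so invariant subgroups are closed under projections, and as in the Baur--Monk theorem every
  formula is a Boolean combination of invariant subgroups. Hence the number of traces on \<open>t\<close> points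
  is at most the number of intersections of \<open>O(t)\<close> cosets of finitely many invariant subgroups of
  \<open>A\<^bsup>|y|\<^esup>\<close>, which is \<open>O(t\<^sup>D)\<close> if every intersection of these subgroups agrees up to finite
  index with the intersection of \<open>D\<close> of them. An induction on \<open>|y|\<close> reduces the bound \<open>D \<le> d |y|\<close> to
  subgroups of \<open>A\<close> itself. For these, the \<open>p\<close>-part is determined up to finite index by the least
  \<open>f(i)\<close> with \<open>p\<^bsup>f(i)\<^esup>e\<close> in the subgroup, where \<open>e\<close> generates a cyclic summand of order \<open>p\<^bsup>i+1\<^esup>\<close> and
  \<open>i\<close> runs over the indices with infinite Ulm invariant. Intersection is the maximum of such
  functions, and \<open>f(i) \<le> f(i') \<le> f(i) + i' - i\<close> for \<open>i \<le> i'\<close>, so that the places where members of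
  an irredundant family are the unique maximum are at distance at least two.\<close>

section \<open>Natural multiples in an abelian group\<close>

lemma nmul_plus: "nmul n (a + b) = nmul n a + nmul n b"
  by (induction n) (auto simp: algebra_simps)

lemma nmul_uminus: "nmul n (- a) = - nmul n a"
  by (induction n) (auto simp: algebra_simps)

lemma nmul_diff: "nmul n (a - b) = nmul n a - nmul n b"
  using nmul_plus[of n a "- b"] by (simp add: nmul_uminus)

lemma nmul_commute: "nmul m (nmul n a) = nmul n (nmul m a)"
  by (metis mult.commute nmul_mult)

lemma nmul_Pair: "nmul n (a, b) = (nmul n a, nmul n b)"
  by (induction n) (auto simp: zero_prod_def)

lemma finite_exponentE:
  assumes "finite_exponent TYPE('a::ab_group_add)"
  obtains N where "N > 0" "\<And>a::'a. nmul N a = 0"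
  using assms unfolding finite_exponent_def by blast


section \<open>Subgroups and cosets\<close>

definition is_subgroup :: "'a::ab_group_add set \<Rightarrow> bool" where
  "is_subgroup G \<longleftrightarrow> 0 \<in> G \<and> (\<forall>a\<in>G. \<forall>b\<in>G. a - b \<in> G)"

lemma subgroup_zero: "is_subgroup G \<Longrightarrow> 0 \<in> G"
  and subgroup_diff: "is_subgroup G \<Longrightarrow> a \<in> G \<Longrightarrow> b \<in> G \<Longrightarrow> a - b \<in> G"
  by (auto simp: is_subgroup_def)

lemma subgroup_uminus: "is_subgroup G \<Longrightarrow> a \<in> G \<Longrightarrow> - a \<in> G"
  using subgroup_diff[of G 0 a] subgroup_zero[of G] by simp

lemma subgroup_add: "is_subgroup G \<Longrightarrow> a \<in> G \<Longrightarrow> b \<in> G \<Longrightarrow> a + b \<in> G"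
  using subgroup_diff[of G a "- b"] subgroup_uminus[of G b] by simp

lemma subgroup_nmul: "is_subgroup G \<Longrightarrow> a \<in> G \<Longrightarrow> nmul n a \<in> G"
  by (induction n) (auto simp: subgroup_zero subgroup_add)

lemma subgroup_Int: "is_subgroup G \<Longrightarrow> is_subgroup H \<Longrightarrow> is_subgroup (G \<inter> H)"
  by (auto simp: is_subgroup_def)

lemma subgroup_INT: "(\<And>i. i \<in> I \<Longrightarrow> is_subgroup (G i)) \<Longrightarrow> is_subgroup (\<Inter>i\<in>I. G i)"
  by (auto simp: is_subgroup_def)

text \<open>With a finite exponent, \<open>- b\<close> is a natural multiple of \<open>b\<close>.\<close>

lemma subgroup_if_closed_add:
  fixes G :: "'a::ab_group_add set"
  assumes "N > 0" "\<And>a::'a. nmul N a = 0" "0 \<in> G"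
    and add: "\<And>a b. a \<in> G \<Longrightarrow> b \<in> G \<Longrightarrow> a + b \<in> G"
  shows "is_subgroup G"
  unfolding is_subgroup_def
proof (intro conjI ballI)
  fix a b assume ab: "a \<in> G" "b \<in> G"
  have "nmul n b \<in> G" for n
    by (induction n) (auto simp: assms ab)
  moreover have "b + nmul (N - 1) b = 0"
    using assms(1) assms(2)[of b] by (metis Suc_diff_1 nmul.simps(2))
  then have "nmul (N - 1) b = - b"
    by (simp add: eq_neg_iff_add_eq_0 add.commute)
  ultimately show "a - b \<in> G"
    using add[OF ab(1), of "- b"] by (metis diff_conv_add_uminus)
qed (rule assms)

definition coset :: "'a::ab_group_add set \<Rightarrow> 'a \<Rightarrow> 'a set" where
  "coset G a = (+) a ` G"

lemma mem_coset: "x \<in> coset G a \<longleftrightarrow> x - a \<in> G"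
  unfolding coset_def by (auto simp: image_iff algebra_simps intro!: bexI[of _ "x - a"])

lemma coset_eq:
  assumes "is_subgroup G"
  shows "coset G a = coset G b \<longleftrightarrow> a - b \<in> G"
proof
  assume "coset G a = coset G b"
  then show "a - b \<in> G"
    using mem_coset[of a G a] mem_coset[of a G b] subgroup_zero[OF assms] by simp
next
  assume ab: "a - b \<in> G"
  have "x - a \<in> G \<longleftrightarrow> x - b \<in> G" for x
    using subgroup_add[OF assms, of "x - a" "a - b"] subgroup_diff[OF assms, of "x - b" "a - b"] ab
    by auto
  then show "coset G a = coset G b"
    by (auto simp: mem_coset)
qed

lemma coset_Int: "coset (G \<inter> H) a = coset G a \<inter> coset H a"
  by (auto simp: mem_coset)

text \<open>\<open>fin_index K H\<close>: the set \<open>K\<close> meets only finitely many cosets of \<open>H\<close>; for subgroups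
  \<open>H \<subseteq> K\<close> this says that \<open>H\<close> has finite index in \<open>K\<close>.\<close>

definition fin_index :: "'a::ab_group_add set \<Rightarrow> 'a set \<Rightarrow> bool" where
  "fin_index K H \<longleftrightarrow> finite (coset H ` K)"

lemma fin_index_mono: "fin_index K H \<Longrightarrow> K' \<subseteq> K \<Longrightarrow> fin_index K' H"
  unfolding fin_index_def by (meson finite_subset image_mono)

text \<open>The map \<open>f\<close> acts as a finite colouring of \<open>K\<close> whose classes
  each lie in one coset of \<open>H\<close>. It is not assumed to be a homomorphism, which later
  allows colourings built from arbitrarily chosen witnesses.\<close>

lemma fin_indexI:
  assumes "is_subgroup H" "finite (f ` K)"
    and "\<And>a b. a \<in> K \<Longrightarrow> b \<in> K \<Longrightarrow> f a = f b \<Longrightarrow> a - b \<in> H"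
  shows "fin_index K H"
proof -
  have "coset H ` K \<subseteq> (\<lambda>z. coset H (SOME b. b \<in> K \<and> f b = z)) ` f ` K"
  proof safe
    fix a assume a: "a \<in> K"
    define b where "b = (SOME b. b \<in> K \<and> f b = f a)"
    have "b \<in> K \<and> f b = f a"
      unfolding b_def by (rule someI[of _ a]) (use a in auto)
    then have "coset H a = coset H b"
      using assms a by (simp add: coset_eq)
    then show "coset H a \<in> (\<lambda>z. coset H (SOME b. b \<in> K \<and> f b = z)) ` f ` K"
      using a unfolding b_def by blast
  qed
  then show ?thesis
    unfolding fin_index_def using assms(2) by (meson finite_imageI finite_subset)
qed

lemma fin_index_Int:
  assumes "fin_index K G" "fin_index K H"
  shows "fin_index K (G \<inter> H)"
proof -
  have "coset (G \<inter> H) ` K \<subseteq> (\<lambda>(X, Y). X \<inter> Y) ` (coset G ` K \<times> coset H ` K)"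
    by (auto simp: coset_Int)
  then show ?thesis
    using assms unfolding fin_index_def by (meson finite_SigmaI finite_imageI finite_subset)
qed

lemma fin_index_UNIV: "fin_index K UNIV"
proof -
  have "coset UNIV ` K \<subseteq> {UNIV}"
    by (auto simp: mem_coset)
  then show ?thesis
    unfolding fin_index_def by (simp add: finite_subset)
qed

lemma fin_index_INT:
  assumes "finite I" "\<And>i. i \<in> I \<Longrightarrow> fin_index K (G i)"
  shows "fin_index K (\<Inter>i\<in>I. G i)"
  using assms by (induction I) (auto intro: fin_index_UNIV fin_index_Int)

lemma fin_index_iff_cover:
  assumes "is_subgroup H"
  shows "fin_index K H \<longleftrightarrow> (\<exists>F. finite F \<and> K \<subseteq> (\<Union>t\<in>F. coset H t))"
proof
  assume "fin_index K H"
  then obtain F where F: "finite F" "coset H ` K = coset H ` F"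
    unfolding fin_index_def by (metis finite_subset_image subset_refl)
  have "a \<in> coset H a" for a
    using assms by (simp add: mem_coset subgroup_zero)
  then have "K \<subseteq> (\<Union>t\<in>F. coset H t)"
    using F(2) by blast
  with F show "\<exists>F. finite F \<and> K \<subseteq> (\<Union>t\<in>F. coset H t)"
    by blast
next
  assume "\<exists>F. finite F \<and> K \<subseteq> (\<Union>t\<in>F. coset H t)"
  then obtain F where F: "finite F" "K \<subseteq> (\<Union>t\<in>F. coset H t)"
    by blast
  have "coset H ` K \<subseteq> coset H ` F"
  proof safe
    fix a assume "a \<in> K"
    then obtain t where "t \<in> F" "a - t \<in> H"
      using F by (auto simp: mem_coset)
    then show "coset H a \<in> coset H ` F"
      using coset_eq[OF assms] by blast
  qed
  then show "fin_index K H"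
    unfolding fin_index_def using F(1) by (meson finite_imageI finite_subset)
qed

lemma fin_index_trans:
  assumes H: "is_subgroup H" and G: "is_subgroup G"
    and "fin_index K H" "fin_index H G"
  shows "fin_index K G"
proof -
  obtain F where F: "finite F" "K \<subseteq> (\<Union>t\<in>F. coset H t)"
    using assms fin_index_iff_cover by blast
  obtain F' where F': "finite F'" "H \<subseteq> (\<Union>t\<in>F'. coset G t)"
    using assms fin_index_iff_cover by blast
  have "K \<subseteq> (\<Union>t\<in>(\<lambda>(a, b). a + b) ` (F \<times> F'). coset G t)"
  proof
    fix a assume "a \<in> K"
    then obtain t where t: "t \<in> F" "a - t \<in> H"
      using F by (auto simp: mem_coset)
    then obtain s where s: "s \<in> F'" "a - t - s \<in> G"
      using F' by (auto simp: mem_coset subset_iff)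
    then have "a \<in> coset G (t + s)"
      by (simp add: mem_coset diff_diff_eq)
    then show "a \<in> (\<Union>t\<in>(\<lambda>(a, b). a + b) ` (F \<times> F'). coset G t)"
      using t s by auto
  qed
  moreover have "finite ((\<lambda>(a, b). a + b) ` (F \<times> F'))"
    using F F' by auto
  ultimately show ?thesis
    using fin_index_iff_cover[OF G] by blast
qed

lemma fin_index_self: "is_subgroup H \<Longrightarrow> fin_index H H"
  by (rule fin_indexI[where f = "\<lambda>_. ()"]) (auto simp: subgroup_diff)


section \<open>Coverings by cosets\<close>

text \<open>B. H. Neumann's lemma. If translates of \<open>H\<close> alone do not cover
  \<open>K\<close>, some coset \<open>a + (H \<inter> K)\<close> avoids all of them and is covered
  by the remaining subgroups. Translating this covering to each piece of \<open>K\<close> in a coset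
  of \<open>H\<close> eliminates \<open>H\<close>, at the cost of the enlarged finite set
  \<open>T'\<close> of representatives.\<close>

lemma Neumann_cover:
  fixes K :: "'a::ab_group_add set"
  assumes "finite HH" "finite T" "is_subgroup K" "\<And>H. H \<in> HH \<Longrightarrow> is_subgroup H"
    and "K \<subseteq> (\<Union>H\<in>HH. \<Union>t\<in>T. coset H t)"
  shows "\<exists>H\<in>HH. fin_index K H"
  using assms
proof (induction HH arbitrary: T rule: finite_induct)
  case empty
  then show ?case
    using subgroup_zero[of K] by auto
next
  case (insert H HH)
  have H: "is_subgroup H"
    using insert.prems by auto
  show ?case
  proof (cases "K \<subseteq> (\<Union>t\<in>T. coset H t)")
    case True
    then show ?thesis
      using H insert.prems fin_index_iff_cover by blast
  next
    case False
    then obtain a where "a \<in> K" "a \<notin> (\<Union>t\<in>T. coset H t)"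
      by blast
    then have a: "a \<in> K" "\<And>t. t \<in> T \<Longrightarrow> a - t \<notin> H"
      by (auto simp: mem_coset)
    have tr: "\<exists>H'\<in>HH. \<exists>t\<in>T. a + h - t \<in> H'" if h: "h \<in> H" "h \<in> K" for h
    proof -
      have ah: "a + h \<in> K"
        using a h insert.prems by (simp add: subgroup_add)
      then obtain H' t where t: "H' \<in> insert H HH" "t \<in> T" "a + h - t \<in> H'"
        using subsetD[OF insert.prems(4) ah] by (auto simp: mem_coset)
      have "H' \<noteq> H"
        using a(2)[OF t(2)] t(3) subgroup_diff[OF H, of "a + h - t" h] h
        by (auto simp: algebra_simps)
      then show ?thesis
        using t by auto
    qed
    define b where "b t = (SOME b. b \<in> K \<and> b - t \<in> H)" for t
    define T' where "T' = T \<union> (\<lambda>(t, s). b t - a + s) ` (T \<times> T)"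
    have "K \<subseteq> (\<Union>H\<in>HH. \<Union>t\<in>T'. coset H t)"
    proof
      fix c assume c: "c \<in> K"
      then obtain H' t where t: "H' \<in> insert H HH" "t \<in> T" "c - t \<in> H'"
        using subsetD[OF insert.prems(4) c] by (auto simp: mem_coset)
      show "c \<in> (\<Union>H\<in>HH. \<Union>t\<in>T'. coset H t)"
      proof (cases "H' = H")
        case False
        then show ?thesis
          using t by (auto simp: T'_def mem_coset)
      next
        case True
        have b: "b t \<in> K \<and> b t - t \<in> H"
          unfolding b_def by (rule someI[of _ c]) (use c t True in auto)
        have "c - b t \<in> H" "c - b t \<in> K"
          using subgroup_diff[OF H, of "c - t" "b t - t"] b t True c
            subgroup_diff[OF insert.prems(2), of c "b t"] by auto
        then obtain H'' s where s: "H'' \<in> HH" "s \<in> T" "a + (c - b t) - s \<in> H''"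
          using tr by blast
        then have "c - (b t - a + s) \<in> H''"
          by (simp add: algebra_simps)
        moreover have "b t - a + s \<in> T'"
          using t s by (auto simp: T'_def)
        ultimately show ?thesis
          using s by (auto simp: mem_coset)
      qed
    qed
    moreover have "finite T'"
      using insert.prems by (auto simp: T'_def)
    ultimately have "\<exists>H\<in>HH. fin_index K H"
      using insert.IH[of T'] insert.prems by auto
    then show ?thesis
      by auto
  qed
qed

section \<open>Counting cosets outside a union of cosets\<close>

definition empty_or_coset :: "'a::ab_group_add set \<Rightarrow> 'a set \<Rightarrow> bool" where
  "empty_or_coset H C \<longleftrightarrow> (\<forall>a\<in>C. C = coset H a)"

lemma empty_or_coset_Int:
  assumes "empty_or_coset H C" "empty_or_coset H' C'"
  shows "empty_or_coset (H \<inter> H') (C \<inter> C')"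
  using assms unfolding empty_or_coset_def by (auto simp: coset_Int)

lemma empty_or_coset_mem:
  assumes "empty_or_coset H C" "a \<in> C"
  shows "b \<in> C \<longleftrightarrow> b - a \<in> H"
  using assms unfolding empty_or_coset_def by (metis mem_coset)

lemma card_cosets_of_coset:
  assumes "is_subgroup K"
  shows "card (coset K ` coset H a) = card (coset K ` H)"
proof -
  have eq: "coset K (a + h) = (+) a ` coset K h" for h
    unfolding coset_def by (auto simp: image_image add.assoc)
  have "coset K ` coset H a = (\<lambda>X. (+) a ` X) ` coset K ` H"
    unfolding coset_def[of H] by (auto simp: image_image eq)
  moreover have "inj (\<lambda>X. (+) a ` X)"
    by (intro inj_onI) (simp add: inj_image_eq_iff)
  ultimately show ?thesis
    by (metis card_image inj_on_subset subset_UNIV)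
qed

text \<open>Inclusion-exclusion: every nonempty intersection is a coset, and its number of
  \<open>K\<close>-cosets depends only on its direction group. Hence only the pattern of empty
  intersections matters. \<open>H0\<close> and \<open>C0\<close> vary in the induction because
  removing the index \<open>j\<close> also leads to the count inside
  \<open>C0 \<inter> C j\<close>.\<close>

lemma card_cosets_diff_cong:
  assumes "finite I" "is_subgroup K" "is_subgroup H0" "K \<subseteq> H0" "fin_index H0 K"
    and "empty_or_coset H0 C0" "empty_or_coset H0 C0'"
    and "\<And>i. i \<in> I \<Longrightarrow> is_subgroup (H i) \<and> K \<subseteq> H i"
    and "\<And>i. i \<in> I \<Longrightarrow> empty_or_coset (H i) (C i) \<and> empty_or_coset (H i) (C' i)"
    and "\<And>D. D \<subseteq> I \<Longrightarrow> C0 \<inter> (\<Inter>i\<in>D. C i) = {} \<longleftrightarrow> C0' \<inter> (\<Inter>i\<in>D. C' i) = {}"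
  shows "card (coset K ` (C0 - (\<Union>i\<in>I. C i))) = card (coset K ` (C0' - (\<Union>i\<in>I. C' i)))"
  using assms
proof (induction I arbitrary: H0 C0 C0' rule: finite_induct)
  case empty
  have "C0 = {} \<longleftrightarrow> C0' = {}"
    using empty.prems(9)[of "{}"] by simp
  moreover have "card (coset K ` X) = card (coset K ` H0)" if "X \<noteq> {}" "empty_or_coset H0 X" for X
    using that card_cosets_of_coset[OF empty.prems(1)] unfolding empty_or_coset_def by auto
  ultimately show ?case
    using empty.prems by (cases "C0 = {}") auto
next
  case (insert j I)
  \<comment> \<open>Since \<open>K \<subseteq> H j\<close>, each coset of \<open>K\<close> lies
    inside \<open>D j\<close> or misses it, so the two counts do not overlap.\<close>
  have split: "card (coset K ` (D0 - (\<Union>i\<in>I. D i)))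
      = card (coset K ` (D0 \<inter> D j - (\<Union>i\<in>I. D i))) + card (coset K ` (D0 - (\<Union>i\<in>insert j I. D i)))"
    if D0: "empty_or_coset H0 D0" and D: "\<And>i. i \<in> insert j I \<Longrightarrow> empty_or_coset (H i) (D i)" for D0 D
  proof -
    have un: "coset K ` (D0 - (\<Union>i\<in>I. D i)) = coset K ` (D0 \<inter> D j - (\<Union>i\<in>I. D i))
        \<union> coset K ` (D0 - (\<Union>i\<in>insert j I. D i))"
      by auto
    have "fin_index D0 K"
    proof (cases "D0 = {}")
      case False
      then obtain a where a: "D0 = coset H0 a"
        using D0 unfolding empty_or_coset_def by blast
      show ?thesis
      proof (rule fin_indexI[where f = "\<lambda>b. coset K (b - a)"])
        show "finite ((\<lambda>b. coset K (b - a)) ` D0)"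
          by (rule finite_subset[of _ "coset K ` H0"])
            (use insert.prems(4) in \<open>auto simp: a mem_coset fin_index_def\<close>)
      qed (use insert.prems(1) in \<open>auto simp: coset_eq\<close>)
    qed (auto simp: fin_index_def)
    then have fin: "finite (coset K ` D0)"
      by (simp add: fin_index_def)
    have "coset K ` (D0 \<inter> D j - (\<Union>i\<in>I. D i)) \<inter> coset K ` (D0 - (\<Union>i\<in>insert j I. D i)) = {}"
    proof (rule ccontr)
      assume "\<not> ?thesis"
      then obtain a b where ab: "a \<in> D j" "b \<notin> D j" "coset K a = coset K b"
        by auto
      then have "b - a \<in> H j"
        using insert.prems(1,7) coset_eq[of K b a] by auto
      then show False
        using ab empty_or_coset_mem[OF D[of j] ab(1)] by auto
    qed
    then show ?thesis
      unfolding un by (intro card_Un_disjoint finite_subset[OF _ fin]) auto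
  qed
  have IH1: "card (coset K ` (C0 - (\<Union>i\<in>I. C i))) = card (coset K ` (C0' - (\<Union>i\<in>I. C' i)))"
  proof (rule insert.IH[of H0])
    show "C0 \<inter> (\<Inter>i\<in>D. C i) = {} \<longleftrightarrow> C0' \<inter> (\<Inter>i\<in>D. C' i) = {}" if "D \<subseteq> I" for D
      using insert.prems(9)[of D] that by blast
  qed (use insert.prems in auto)
  have IH2: "card (coset K ` (C0 \<inter> C j - (\<Union>i\<in>I. C i)))
      = card (coset K ` (C0' \<inter> C' j - (\<Union>i\<in>I. C' i)))"
  proof (rule insert.IH[of "H0 \<inter> H j"])
    show "fin_index (H0 \<inter> H j) K"
      using insert.prems by (auto intro: fin_index_mono)
    show "C0 \<inter> C j \<inter> (\<Inter>i\<in>D. C i) = {} \<longleftrightarrow> C0' \<inter> C' j \<inter> (\<Inter>i\<in>D. C' i) = {}" if "D \<subseteq> I" for D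
      using insert.prems(9)[of "insert j D"] that by (auto simp: Int_assoc)
  qed (use insert.prems in \<open>auto intro: subgroup_Int empty_or_coset_Int\<close>)
  show ?case
    using split[of C0 C] split[of C0' C'] IH1 IH2 insert.prems(5,6,8) by auto
qed

text \<open>Whether cosets cover \<open>C0\<close> can be read off from the pattern of empty
  intersections. Neumann's lemma discards the groups of infinite index in \<open>H0\<close>; the
  others contain a common subgroup \<open>K\<close> of finite index, and counting cosets of
  \<open>K\<close> compares the two uncovered remainders.\<close>

lemma coset_cover_cong:
  assumes "finite I" and H0: "is_subgroup H0"
    and C0: "empty_or_coset H0 C0" "empty_or_coset H0 C0'"
    and H: "\<And>i. i \<in> I \<Longrightarrow> is_subgroup (H i)"
    and C: "\<And>i. i \<in> I \<Longrightarrow> empty_or_coset (H i) (C i) \<and> empty_or_coset (H i) (C' i)"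
    and pat: "\<And>D. D \<subseteq> I \<Longrightarrow> C0 \<inter> (\<Inter>i\<in>D. C i) = {} \<longleftrightarrow> C0' \<inter> (\<Inter>i\<in>D. C' i) = {}"
    and cov: "C0 \<subseteq> (\<Union>i\<in>I. C i)"
  shows "C0' \<subseteq> (\<Union>i\<in>I. C' i)"
proof -
  define If where "If = {i \<in> I. fin_index H0 (H i)}"
  define K where "K = H0 \<inter> (\<Inter>i\<in>If. H i)"
  have K: "is_subgroup K"
    unfolding K_def by (intro subgroup_Int subgroup_INT H0) (auto simp: If_def H)
  have "fin_index H0 (\<Inter>i\<in>If. H i)"
    using assms(1) by (intro fin_index_INT) (auto simp: If_def)
  then have fin: "fin_index H0 K"
    unfolding K_def by (intro fin_index_Int fin_index_self H0)
  \<comment> \<open>A point \<open>a\<close> missed by the finite-index members would leave all of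
    \<open>a + K\<close> to the infinite-index ones, contrary to Neumann's lemma.\<close>
  have cov': "C0 \<subseteq> (\<Union>i\<in>If. C i)"
  proof (rule ccontr)
    assume "\<not> ?thesis"
    then obtain a where a: "a \<in> C0" "\<And>i. i \<in> If \<Longrightarrow> a \<notin> C i"
      by blast
    define b where "b i = (SOME b. b \<in> C i)" for i
    have "K \<subseteq> (\<Union>G\<in>H ` (I - If). \<Union>t\<in>(\<lambda>i. b i - a) ` I. coset G t)"
    proof
      fix k assume k: "k \<in> K"
      have "a + k \<in> C0"
        using k empty_or_coset_mem[OF C0(1) a(1), of "a + k"] by (auto simp: K_def)
      then obtain i where i: "i \<in> I" "a + k \<in> C i"
        using cov by blast
      have "i \<notin> If"
      proof
        assume iI: "i \<in> If"
        then have "- k \<in> H i"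
          using k H[OF i(1)] by (auto simp: K_def intro: subgroup_uminus)
        then have "a \<in> C i"
          using empty_or_coset_mem[of "H i" "C i" "a + k" a] C[OF i(1)] i(2) by auto
        then show False
          using a(2)[OF iI] by blast
      qed
      have "b i \<in> C i"
        unfolding b_def using i(2) by (rule someI)
      then have "a + k - b i \<in> H i"
        using empty_or_coset_mem[of "H i" "C i" "b i"] C[OF i(1)] i(2) by auto
      then have "k \<in> coset (H i) (b i - a)"
        by (simp add: mem_coset algebra_simps)
      then show "k \<in> (\<Union>G\<in>H ` (I - If). \<Union>t\<in>(\<lambda>i. b i - a) ` I. coset G t)"
        using i(1) \<open>i \<notin> If\<close> by blast
    qed
    then have "\<exists>G\<in>H ` (I - If). fin_index K G"
      using assms(1) K H by (intro Neumann_cover[where T = "(\<lambda>i. b i - a) ` I"]) auto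
    then obtain i where i: "i \<in> I" "i \<notin> If" "fin_index K (H i)"
      by blast
    then have "fin_index H0 (H i)"
      using fin_index_trans[OF K H fin] by blast
    then show False
      using i by (simp add: If_def)
  qed
  have "card (coset K ` (C0 - (\<Union>i\<in>If. C i))) = card (coset K ` (C0' - (\<Union>i\<in>If. C' i)))"
  proof (rule card_cosets_diff_cong[where ?H0.0 = H0 and H = H])
    show "C0 \<inter> (\<Inter>i\<in>D. C i) = {} \<longleftrightarrow> C0' \<inter> (\<Inter>i\<in>D. C' i) = {}" if "D \<subseteq> If" for D
      using pat[of D] that by (auto simp: If_def)
  qed (use assms(1) K H0 C0 H C fin in \<open>auto simp: If_def K_def\<close>)
  then have "card (coset K ` (C0' - (\<Union>i\<in>If. C' i))) = 0"
    using cov' by (simp add: Diff_eq_empty_iff[THEN iffD2])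
  \<comment> \<open>Cardinality 0 means emptiness only once finiteness is known.\<close>
  moreover have "finite (coset K ` C0')"
  proof (cases "C0' = {}")
    case False
    then obtain a where "C0' = coset H0 a"
      using C0 unfolding empty_or_coset_def by blast
    then have "fin_index C0' H0"
      by (intro iffD2[OF fin_index_iff_cover[OF H0]] exI[of _ "{a}"]) simp
    then show ?thesis
      using fin_index_trans[OF H0 K _ fin] by (simp add: fin_index_def)
  qed auto
  then have "finite (coset K ` (C0' - (\<Union>i\<in>If. C' i)))"
    by (rule finite_subset[rotated]) auto
  ultimately have "C0' - (\<Union>i\<in>If. C' i) = {}"
    by simp
  then show ?thesis
    by (auto simp: If_def)
qed


section \<open>Heights\<close>

definition multiples :: "nat \<Rightarrow> 'a::ab_group_add set" where
  "multiples n = range (nmul n)"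

lemma subgroup_multiples: "is_subgroup (multiples n)"
  unfolding is_subgroup_def multiples_def
  by (auto simp flip: nmul_diff intro: range_eqI[of _ _ 0])

lemma multiples_1 [simp]: "multiples (Suc 0) = UNIV"
  by (simp add: multiples_def)

lemma multiples_dvd: "m dvd n \<Longrightarrow> multiples n \<subseteq> multiples m"
  unfolding multiples_def by (auto simp: nmul_mult)

lemma multiples_power_mono: "l \<le> k \<Longrightarrow> multiples (p ^ k) \<subseteq> multiples (p ^ l)"
  by (intro multiples_dvd le_imp_power_dvd)

lemma nmul_in_multiples: "a \<in> multiples n \<Longrightarrow> nmul m a \<in> multiples (m * n)"
  unfolding multiples_def by (auto simp: nmul_mult)

lemma multiples_cancel_coprime:
  assumes "coprime m n" "nmul m a \<in> multiples n"
  shows "a \<in> multiples n"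
proof (cases "m = 0")
  case True
  then show ?thesis
    using assms by auto
next
  case False
  then obtain x y where xy: "m * x = n * y + 1"
    using bezout_nat[of m n] assms(1) by auto
  have "nmul x (nmul m a) - nmul (n * y) a = a"
    using arg_cong[OF xy, of "\<lambda>k. nmul k a"]
    by (simp only: nmul_add_left nmul_mult nmul_commute[of x m]) simp
  moreover have "nmul (n * y) a \<in> multiples n"
    by (auto simp: nmul_mult multiples_def)
  ultimately show ?thesis
    using subgroup_diff[OF subgroup_multiples[of n] subgroup_nmul[OF subgroup_multiples assms(2), of x]]
    by metis
qed

lemma multiples_mult_coprime:
  assumes "coprime m n" "a \<in> multiples m" "a \<in> multiples n"
  shows "a \<in> multiples (m * n)"
proof -
  obtain b where b: "a = nmul n b"
    using assms by (auto simp: multiples_def)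
  then have "nmul n b \<in> multiples m"
    using assms(2) by simp
  then have "b \<in> multiples m"
    using multiples_cancel_coprime[of n m b] assms(1) by (simp add: coprime_commute)
  then show ?thesis
    using nmul_in_multiples[of b m n] b by (simp add: mult.commute)
qed

lemma prime_power_splitE:
  fixes n :: nat
  assumes "n > 0" "prime p"
  obtains m k where "n = m * p ^ k" "coprime m p" "m > 0"
proof -
  obtain k m where km: "\<not> p dvd m" "n = m * p ^ k"
    using prime_power_canonical[OF assms(2,1)] by blast
  then show ?thesis
    using that[of m k] assms(1) prime_imp_coprime[OF assms(2) km(1)]
    by (simp add: coprime_commute)
qed

lemma in_multiples_if_prime_powers:
  assumes "\<And>q l. prime q \<Longrightarrow> a \<in> multiples (q ^ l)" "n > 0"
  shows "a \<in> multiples n"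
  using assms(2)
proof (induction n rule: less_induct)
  case (less n)
  show ?case
  proof (cases "n = 1")
    case False
    then obtain p where p: "prime p" "p dvd n"
      using prime_factor_nat by blast
    obtain m k where mk: "n = m * p ^ k" "coprime m p" "m > 0"
      using prime_power_splitE[OF less.prems p(1)] .
    have "k \<noteq> 0"
      using mk p not_prime_unit[of p] by (cases k) (auto simp: coprime_absorb_right)
    then have "m < n"
      using mk one_less_power[OF prime_gt_1_nat[OF p(1)], of k] by simp
    then have "a \<in> multiples m"
      using less.IH mk by blast
    then show ?thesis
      using multiples_mult_coprime[of m "p ^ k" a] mk assms(1)[OF p(1)] by simp
  qed simp
qed

text \<open>\<open>L\<close> is the exponent of \<open>p\<close> in \<open>N\<close>. The cofactor
  \<open>m\<close> is prime to \<open>p\<close> and annihilates \<open>multiples (p ^ L)\<close>, so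
  these elements have infinite \<open>p\<close>-height and no \<open>p\<close>-torsion among them
  survives.\<close>

lemma multiples_stable:
  assumes "finite_exponent TYPE('a::ab_group_add)" "prime p"
  obtains L where "\<And>l. multiples (p ^ L) \<subseteq> (multiples (p ^ l) :: 'a set)"
    and "\<And>a::'a. a \<in> multiples (p ^ L) \<Longrightarrow> nmul p a = 0 \<Longrightarrow> a = 0"
proof -
  obtain N where N: "N > 0" "\<And>a::'a. nmul N a = 0"
    using assms(1) by (rule finite_exponentE) blast
  obtain m L where mL: "N = m * p ^ L" "coprime m p" "m > 0"
    using prime_power_splitE[OF N(1) assms(2)] .
  have kill: "nmul m a = 0" if "a \<in> multiples (p ^ L)" for a :: 'a
    using that N(2) unfolding mL by (auto simp: nmul_mult multiples_def)
  show ?thesis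
  proof (rule that[of L])
    show "multiples (p ^ L) \<subseteq> (multiples (p ^ l) :: 'a set)" for l
    proof
      fix a :: 'a assume "a \<in> multiples (p ^ L)"
      then have "nmul m a \<in> multiples (p ^ l)"
        using kill subgroup_zero[OF subgroup_multiples] by simp
      then show "a \<in> multiples (p ^ l)"
        using multiples_cancel_coprime[of m "p ^ l"] mL(2) by simp
    qed
    show "a = 0" if "a \<in> multiples (p ^ L)" "nmul p a = 0" for a :: 'a
      using nmul_gcd_eq_0[OF kill[OF that(1)] that(2)] mL(2) by simp
  qed
qed


section \<open>Height-nondecreasing relations\<close>

text \<open>A partial homomorphism that does not decrease heights, given by its graph. In a group of
  finite exponent single-valuedness is automatic, since only \<open>0\<close> has infinite height at all primes.\<close>

definition height_rel :: "('a::ab_group_add \<times> 'a) set \<Rightarrow> bool" where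
  "height_rel R \<longleftrightarrow> is_subgroup R \<and>
     (\<forall>s t q l. (s, t) \<in> R \<longrightarrow> prime q \<longrightarrow> s \<in> multiples (q ^ l) \<longrightarrow> t \<in> multiples (q ^ l))"

text \<open>The element 0 has infinite height at every prime, so its partner has too and lies in
  \<open>multiples N\<close>, which is trivial.\<close>

lemma height_rel_zero:
  assumes "finite_exponent TYPE('a::ab_group_add)" "height_rel R" "(0, t :: 'a) \<in> R"
  shows "t = 0"
proof -
  obtain N where N: "N > 0" "\<And>a::'a. nmul N a = 0"
    using assms(1) by (rule finite_exponentE) blast
  have "t \<in> multiples (q ^ l)" if "prime q" for q l
    using assms(2,3) that subgroup_zero[OF subgroup_multiples] unfolding height_rel_def by blast
  then have "t \<in> multiples N"
    using N(1) by (rule in_multiples_if_prime_powers)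
  then show ?thesis
    using N(2) by (auto simp: multiples_def)
qed

text \<open>The extension step of Kaplansky and Mackey for Ulm's theorem. Modulo the domain,
  \<open>c\<close> is replaced by \<open>c0\<close> of maximal \<open>p\<close>-height
  \<open>r\<close>. The partner \<open>t1\<close> of \<open>nmul p c0\<close> has height at least
  \<open>r + 1\<close>, so it is \<open>p\<close> times some \<open>d\<close> of height at least
  \<open>r\<close>, and \<open>c0\<close> may be paired with \<open>d\<close>.\<close>

lemma height_rel_extend_prime:
  fixes c :: "'a::ab_group_add"
  assumes fe: "finite_exponent TYPE('a)" and R: "height_rel R" and p: "prime p"
    and pc: "nmul p c \<in> Domain R"
  shows "\<exists>R'. height_rel R' \<and> R \<subseteq> R' \<and> c \<in> Domain R'"
proof -
  obtain N where N: "N > 0" "\<And>a::'a. nmul N a = 0"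
    using fe by (rule finite_exponentE) blast
  obtain L where L: "\<And>l. multiples (p ^ L) \<subseteq> (multiples (p ^ l) :: 'a set)"
    by (rule multiples_stable[OF fe p]) (rule that)
  have sR: "is_subgroup R"
    and hR: "\<And>s t q l. (s, t) \<in> R \<Longrightarrow> prime q \<Longrightarrow> s \<in> multiples (q ^ l) \<Longrightarrow> t \<in> multiples (q ^ l)"
    using R by (auto simp: height_rel_def)
  have Radd: "(s + s', t + t') \<in> R" if "(s, t) \<in> R" "(s', t') \<in> R" for s s' t t'
    using subgroup_add[OF sR that] by simp
  have Rnmul: "(nmul k s, nmul k t) \<in> R" if "(s, t) \<in> R" for s t k
    using subgroup_nmul[OF sR that, of k] by (simp add: nmul_Pair)
  \<comment> \<open>Heights are capped at \<open>L\<close>, beyond which all are infinite; this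
    guarantees a maximum.\<close>
  define rs where "rs = {r. r \<le> L \<and> (\<exists>s\<in>Domain R. c + s \<in> multiples (p ^ r))}"
  define r where "r = Max rs"
  have "finite rs"
    by (rule finite_subset[of _ "{..L}"]) (auto simp: rs_def)
  moreover have "0 \<in> rs"
    using subgroup_zero[OF sR] by (auto simp: rs_def zero_prod_def)
  ultimately have r: "r \<in> rs" "\<And>r'. r' \<in> rs \<Longrightarrow> r' \<le> r"
    unfolding r_def by (auto intro: Max_in)
  then obtain s0 t0 where s0: "(s0, t0) \<in> R" "c + s0 \<in> multiples (p ^ r)"
    unfolding rs_def by blast
  define c0 where "c0 = c + s0"
  obtain t1 where t1: "(nmul p c0, t1) \<in> R"
    using pc Radd[OF _ Rnmul[OF s0(1), of p]] by (metis DomainE c0_def nmul_plus)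
  have "nmul p c0 \<in> multiples (p ^ Suc r)"
    using nmul_in_multiples[OF s0(2)] by (simp add: c0_def)
  then have "t1 \<in> multiples (p ^ Suc r)"
    using hR[OF t1 p] by blast
  then obtain d' where d': "t1 = nmul p (nmul (p ^ r) d')"
    by (auto simp: multiples_def nmul_mult)
  define d where "d = nmul (p ^ r) d'"
  have d: "(nmul p c0, nmul p d) \<in> R" "d \<in> multiples (p ^ r)"
    using t1 d' by (auto simp: d_def multiples_def)
  define R' where "R' = {(s + nmul k c0, t + nmul k d) | s t k. (s, t) \<in> R}"
  \<comment> \<open>By maximality of \<open>r\<close>, the capped height of \<open>s + c0\<close> is
    at most \<open>r\<close>. So \<open>c0\<close> and \<open>d\<close> both attain it, hence
    \<open>s\<close> does, and then \<open>t\<close> because \<open>R\<close> respects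
    heights.\<close>
  have one: "t + d \<in> multiples (p ^ l)" if st: "(s, t) \<in> R" and sc: "s + c0 \<in> multiples (p ^ l)" for s t l
  proof -
    define l' where "l' = min l L"
    have "s + c0 \<in> multiples (p ^ l')"
      using sc multiples_power_mono[of l' l p] by (auto simp: l'_def)
    then have sc': "c + (s0 + s) \<in> multiples (p ^ l')"
      by (simp add: c0_def algebra_simps)
    have "s0 + s \<in> Domain R"
      using Radd[OF s0(1) st] by blast
    then have "l' \<in> rs"
      using sc' by (auto simp: rs_def l'_def)
    then have "l' \<le> r"
      using r by blast
    then have mm: "multiples (p ^ r) \<subseteq> (multiples (p ^ l') :: 'a set)"
      by (rule multiples_power_mono)
    then have "c0 \<in> multiples (p ^ l')" "d \<in> multiples (p ^ l')"
      using s0(2) d(2) by (auto simp: c0_def)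
    then have "s \<in> multiples (p ^ l')"
      using subgroup_diff[OF subgroup_multiples[of "p ^ l'"] \<open>s + c0 \<in> multiples (p ^ l')\<close>, of c0] by simp
    then have "t + d \<in> multiples (p ^ l')"
      using hR[OF st p] \<open>d \<in> multiples (p ^ l')\<close> by (simp add: subgroup_add[OF subgroup_multiples])
    then show ?thesis
      using L[of l] by (cases "l \<le> L") (auto simp: l'_def min_def)
  qed
  have "height_rel R'"
    unfolding height_rel_def
  proof (intro conjI allI impI)
    show "is_subgroup R'"
    proof (rule subgroup_if_closed_add[OF N(1)])
      show "nmul N a = 0" for a :: "'a \<times> 'a"
        using N(2) by (cases a) (simp add: nmul_Pair zero_prod_def)
      show "0 \<in> R'"
        unfolding R'_def using subgroup_zero[OF sR] by (auto simp: zero_prod_def intro!: exI[of _ 0])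
      fix a b assume "a \<in> R'" "b \<in> R'"
      then obtain s t k s' t' k' where ab: "a = (s + nmul k c0, t + nmul k d)" "(s, t) \<in> R"
          "b = (s' + nmul k' c0, t' + nmul k' d)" "(s', t') \<in> R"
        unfolding R'_def by blast
      have "a + b = (s + s' + nmul (k + k') c0, t + t' + nmul (k + k') d)"
        using ab by (simp add: nmul_add_left algebra_simps)
      then show "a + b \<in> R'"
        unfolding R'_def using Radd[OF ab(2,4)] by blast
    qed
    fix x y q l
    assume "(x, y) \<in> R'" and q: "prime q" and xl: "x \<in> multiples (q ^ l)"
    then obtain s t k where st: "x = s + nmul k c0" "y = t + nmul k d" "(s, t) \<in> R"
      unfolding R'_def by blast
    have pk: "(nmul p x, nmul p y) \<in> R"
      using Radd[OF Rnmul[OF st(3), of p] Rnmul[OF d(1), of k]]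
      by (simp add: st nmul_plus nmul_commute[of k p])
    show "y \<in> multiples (q ^ l)"
    proof (cases "p dvd k")
      case True
      then obtain m where "k = m * p"
        by (metis dvd_def mult.commute)
      then have "(x, y) \<in> R"
        using Radd[OF st(3) Rnmul[OF d(1), of m]] by (simp add: st nmul_mult)
      then show ?thesis
        using hR q xl by blast
    next
      case pnk: False
      show ?thesis
      proof (cases "q = p")
        case False
        have "nmul p y \<in> multiples (q ^ l)"
          using hR[OF pk q] xl by (simp add: subgroup_nmul[OF subgroup_multiples])
        moreover have "coprime p (q ^ l)"
          using False p q by (simp add: primes_coprime)
        ultimately show ?thesis
          using multiples_cancel_coprime by blast
      next
        case True
        \<comment> \<open>An inverse \<open>k'\<close> of \<open>k\<close> modulo \<open>p\<close>
          brings the coefficient of \<open>c0\<close> to 1: the excess is a multiple of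
          \<open>nmul p c0\<close>, which already lies in the domain of \<open>R\<close>. This
          reduces the claim to \<open>one\<close>.\<close>
        have "coprime k p"
          using pnk p by (metis coprime_commute prime_imp_coprime)
        moreover have "k \<noteq> 0"
          using pnk by (metis dvd_0_right)
        ultimately obtain k' m where km: "k * k' = p * m + 1"
          using bezout_nat[of k p] by auto
        have expand: "nmul k' (u + nmul k w) = (nmul k' u + nmul m (nmul p w)) + w" for u w :: 'a
        proof -
          have "nmul k' (nmul k w) = nmul m (nmul p w) + w"
            using arg_cong[OF km, of "\<lambda>n. nmul n w"]
            by (simp only: nmul_add_left nmul_mult nmul_commute[of k' k] nmul_commute[of m p]) simp
          then show ?thesis
            by (simp add: nmul_plus add.assoc)
        qed
        have "(nmul k' s + nmul m (nmul p c0)) + c0 \<in> multiples (p ^ l)"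
          using subgroup_nmul[OF subgroup_multiples xl, of k'] expand[of s c0] True by (simp add: st)
        then have "(nmul k' t + nmul m (nmul p d)) + d \<in> multiples (p ^ l)"
          using one Radd[OF Rnmul[OF st(3), of k'] Rnmul[OF d(1), of m]] by blast
        then have "nmul k' y \<in> multiples (p ^ l)"
          using expand[of t d] by (simp add: st)
        moreover have "coprime k' p"
        proof (rule coprimeI)
          fix z assume "z dvd k'" "z dvd p"
          then have "z dvd p * m + 1" "z dvd p * m"
            using km by (metis dvd_mult, simp)
          then show "is_unit z"
            using dvd_add_right_iff by blast
        qed
        ultimately show ?thesis
          using multiples_cancel_coprime[of k' "p ^ l"] True by simp
      qed
    qed
  qed
  moreover have "R \<subseteq> R'"
  proof
    fix x assume "x \<in> R"
    moreover obtain s t where "x = (s, t)"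
      by (cases x)
    ultimately have "x = (s + nmul 0 c0, t + nmul 0 d) \<and> (s, t) \<in> R"
      by simp
    then show "x \<in> R'"
      unfolding R'_def by blast
  qed
  moreover have "c \<in> Domain R'"
  proof -
    have "(- s0, - t0) \<in> R"
      using subgroup_uminus[OF sR s0(1)] by simp
    moreover have "c = - s0 + nmul 1 c0"
      by (simp add: c0_def)
    ultimately show ?thesis
      unfolding R'_def Domain_unfold by blast
  qed
  ultimately show ?thesis
    by blast
qed

text \<open>Some positive multiple of \<open>c\<close>, namely \<open>nmul N c = 0\<close>, is in
  the domain. Removing one prime factor of the multiplier at a time reaches
  \<open>c\<close>.\<close>

lemma height_rel_extend:
  fixes c :: "'a::ab_group_add"
  assumes fe: "finite_exponent TYPE('a)" and R: "height_rel R"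
  shows "\<exists>R'. height_rel R' \<and> R \<subseteq> R' \<and> c \<in> Domain R'"
proof -
  have *: "\<exists>R'. height_rel R' \<and> R \<subseteq> R' \<and> c \<in> Domain R'"
    if "M > 0" "height_rel R" "nmul M c \<in> Domain R" for M and R :: "('a \<times> 'a) set"
    using that
  proof (induction M arbitrary: R rule: less_induct)
    case (less M)
    show ?case
    proof (cases "M = 1")
      case True
      then show ?thesis
        using less.prems by (intro exI[of _ R]) auto
    next
      case False
      then obtain p where p: "prime p" "p dvd M"
        using prime_factor_nat by blast
      then obtain M' where M': "M = p * M'"
        by (auto simp: dvd_def)
      have M'M: "M' > 0" "M' < M"
        using less.prems(1) M' prime_gt_1_nat[OF p(1)] by auto
      have "nmul p (nmul M' c) \<in> Domain R"
        using less.prems(3) by (simp add: M' nmul_mult)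
      then obtain R1 where R1: "height_rel R1" "R \<subseteq> R1" "nmul M' c \<in> Domain R1"
        using height_rel_extend_prime[OF fe less.prems(2) p(1)] by blast
      then obtain R2 where "height_rel R2" "R1 \<subseteq> R2" "c \<in> Domain R2"
        using less.IH[OF M'M(2,1)] by blast
      then show ?thesis
        using R1 by blast
    qed
  qed
  obtain N where N: "N > 0" "\<And>a::'a. nmul N a = 0"
    using fe by (rule finite_exponentE) blast
  have "(0, 0) \<in> R"
    using R subgroup_zero[of R] by (simp add: height_rel_def zero_prod_def)
  then have "nmul N c \<in> Domain R"
    using N(2)[of c] by auto
  then show ?thesis
    using *[OF N(1) R] by blast
qed


section \<open>Invariant subgroups of powers and quantifier elimination\<close>

text \<open>Invariant subgroups play the role of the positive primitive definable subgroups.\<close>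

definition invariant :: "('v \<Rightarrow> 'a::ab_group_add) set \<Rightarrow> bool" where
  "invariant P \<longleftrightarrow> is_subgroup P \<and>
     (\<forall>R g h. height_rel R \<longrightarrow> g \<in> P \<longrightarrow> (\<forall>v. (g v, h v) \<in> R) \<longrightarrow> h \<in> P)"

text \<open>Assignments stay total, so this is the cylinder over the projection forgetting
  \<open>v\<close>; it matches the semantics of \<open>Exi\<close>.\<close>

definition proj :: "'v \<Rightarrow> ('v \<Rightarrow> 'a) set \<Rightarrow> ('v \<Rightarrow> 'a) set" where
  "proj v P = {e. \<exists>a. e(v := a) \<in> P}"

lemma invariant_subgroup: "invariant P \<Longrightarrow> is_subgroup P"
  by (simp add: invariant_def)

lemma invariant_Int: "invariant P \<Longrightarrow> invariant Q \<Longrightarrow> invariant (P \<inter> Q)"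
  unfolding invariant_def by (auto simp: subgroup_Int)

lemma invariant_INT: "(\<And>i. i \<in> I \<Longrightarrow> invariant (P i)) \<Longrightarrow> invariant (\<Inter>i\<in>I. P i)"
  unfolding invariant_def by (auto simp: subgroup_INT)

lemma fun_upd_diff: "(e - e')(v := a - a') = e(v := a) - (e'(v := a') :: 'v \<Rightarrow> 'a::ab_group_add)"
  by (auto simp: fun_eq_iff)

text \<open>Extending the height-nondecreasing relation to the witness \<open>a\<close> at
  \<open>v\<close> supplies a witness for the image tuple.\<close>

lemma invariant_proj:
  fixes P :: "('v \<Rightarrow> 'a::ab_group_add) set"
  assumes fe: "finite_exponent TYPE('a)" and P: "invariant P"
  shows "invariant (proj v P)"
  unfolding invariant_def
proof (intro conjI allI impI)
  have sP: "is_subgroup P"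
    using P by (rule invariant_subgroup)
  have "0(v := 0) \<in> P"
    using subgroup_zero[OF sP] by (simp add: zero_fun_def fun_upd_idem)
  moreover have "(e - e')(v := a - a') \<in> P" if "e(v := a) \<in> P" "e'(v := a') \<in> P" for e e' a a'
    using subgroup_diff[OF sP that] by (simp add: fun_upd_diff)
  ultimately show "is_subgroup (proj v P)"
    unfolding is_subgroup_def proj_def by blast
  fix R and g h :: "'v \<Rightarrow> 'a"
  assume R: "height_rel R" and "g \<in> proj v P" and gh: "\<forall>v. (g v, h v) \<in> R"
  then obtain a where a: "g(v := a) \<in> P"
    by (auto simp: proj_def)
  obtain R' b where R': "height_rel R'" "R \<subseteq> R'" "(a, b) \<in> R'"
    using height_rel_extend[OF fe R, of a] by blast
  have "((g(v := a)) w, (h(v := b)) w) \<in> R'" for w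
    using gh R' by auto
  then have "h(v := b) \<in> P"
    using P a R'(1) unfolding invariant_def by blast
  then show "h \<in> proj v P"
    by (auto simp: proj_def)
qed

lemma tval_diff: "tval (e - e') s = tval e s - tval e' s"
  by (induction s) auto

lemma invariant_equation:
  assumes fe: "finite_exponent TYPE('a::ab_group_add)"
  shows "invariant {e :: nat \<Rightarrow> 'a. tval e s = tval e t}"
  unfolding invariant_def
proof (intro conjI allI impI)
  have "tval (0 :: nat \<Rightarrow> 'a) u = 0" for u
    using tval_diff[of "0 :: nat \<Rightarrow> 'a" 0 u] by simp
  then show "is_subgroup {e :: nat \<Rightarrow> 'a. tval e s = tval e t}"
    unfolding is_subgroup_def by (auto simp: tval_diff)
  fix R and g h :: "nat \<Rightarrow> 'a"
  assume R: "height_rel R" and g: "g \<in> {e. tval e s = tval e t}" and gh: "\<forall>v. (g v, h v) \<in> R"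
  have sR: "is_subgroup R"
    using R by (simp add: height_rel_def)
  have "(tval g u, tval h u) \<in> R" for u
  proof (induction u)
    case (Plus u w)
    then show ?case
      using subgroup_add[OF sR Plus.IH] by simp
  qed (use gh subgroup_zero[OF sR] in \<open>auto simp: zero_prod_def\<close>)
  then have "(tval g s - tval g t, tval h s - tval h t) \<in> R"
    using subgroup_diff[OF sR, of "(tval g s, tval h s)" "(tval g t, tval h t)"] by simp
  then show "h \<in> {e. tval e s = tval e t}"
    using height_rel_zero[OF fe R, of "tval h s - tval h t"] g by simp
qed

text \<open>For finite \<open>PP\<close> this says that \<open>Y\<close> is a Boolean combination of
  members of \<open>PP\<close>, without naming the combination.\<close>

definition determined :: "'b set set \<Rightarrow> 'b set \<Rightarrow> bool" where
  "determined PP Y \<longleftrightarrow> (\<forall>e e'. (\<forall>P\<in>PP. e \<in> P \<longleftrightarrow> e' \<in> P) \<longrightarrow> (e \<in> Y \<longleftrightarrow> e' \<in> Y))"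

lemma empty_or_coset_fibre:
  assumes "is_subgroup P"
  shows "empty_or_coset {a. 0(v := a) \<in> P} {a. e(v := a) \<in> P}"
  unfolding empty_or_coset_def
proof
  fix a assume "a \<in> {a. e(v := a) \<in> P}"
  then have a: "e(v := a) \<in> P" by simp
  have "e(v := b) \<in> P \<longleftrightarrow> 0(v := b - a) \<in> P" for b
  proof -
    have "0(v := b - a) = e(v := b) - e(v := a)"
      using fun_upd_diff[of e e v b a] by simp
    then show ?thesis
      using subgroup_diff[OF assms _ a, of "e(v := b)"] subgroup_add[OF assms _ a, of "0(v := b - a)"]
      by auto
  qed
  then show "{a. e(v := a) \<in> P} = coset {a. 0(v := a) \<in> P} a"
    by (intro set_eqI) (simp only: mem_coset mem_Collect_eq)
qed

lemma subgroup_fibre: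
  assumes "is_subgroup P"
  shows "is_subgroup {a. 0(v := a) \<in> P}"
  unfolding is_subgroup_def
proof (intro conjI ballI)
  show "0 \<in> {a. 0(v := a) \<in> P}"
    using subgroup_zero[OF assms] by (simp add: zero_fun_def fun_upd_idem)
  fix a b assume "a \<in> {a. 0(v := a) \<in> P}" "b \<in> {a. 0(v := a) \<in> P}"
  then show "a - b \<in> {a. 0(v := a) \<in> P}"
    using subgroup_diff[OF assms, of "0(v := a)" "0(v := b)"] fun_upd_diff[of 0 0 v a b] by simp
qed

text \<open>Elimination of one quantifier. Agreement on the projections of all intersections means
  that the fibres over \<open>e\<close> and \<open>e'\<close> have the same pattern of empty
  intersections. By \<open>coset_cover_cong\<close>, a value \<open>a\<close> over \<open>e\<close>
  then has a counterpart \<open>a'\<close> over \<open>e'\<close> lying in exactly the same members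
  of \<open>PP\<close>.\<close>

lemma determined_exists:
  fixes PP :: "('v \<Rightarrow> 'a::ab_group_add) set set"
  assumes fin: "finite PP" and sub: "\<And>P. P \<in> PP \<Longrightarrow> is_subgroup P" and det: "determined PP Y"
  shows "determined ((\<lambda>D. proj v (\<Inter>D)) ` Pow PP) {e. \<exists>a. e(v := a) \<in> Y}"
proof -
  have *: "\<exists>a'. e'(v := a') \<in> Y"
    if agree: "\<forall>Q \<in> (\<lambda>D. proj v (\<Inter>D)) ` Pow PP. e \<in> Q \<longleftrightarrow> e' \<in> Q" and a: "e(v := a) \<in> Y" for e e' a
  proof -
    define D0 where "D0 = {P \<in> PP. e(v := a) \<in> P}"
    define fib where "fib e P = {a. e(v := a) \<in> P}" for e :: "'v \<Rightarrow> 'a" and P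
    have fib_Inter: "fib e (\<Inter>D) = (\<Inter>P\<in>D. fib e P)" for e D
      by (auto simp: fib_def)
    have fib_empty: "fib e (\<Inter>D) = {} \<longleftrightarrow> fib e' (\<Inter>D) = {}" if "D \<subseteq> PP" for D
    proof -
      have "e \<in> proj v (\<Inter>D) \<longleftrightarrow> e' \<in> proj v (\<Inter>D)"
        using agree that by blast
      then show ?thesis
        unfolding fib_def proj_def by blast
    qed
    have sD0: "is_subgroup (\<Inter>D0)"
      using subgroup_INT[of D0 "\<lambda>P. P"] sub by (auto simp: D0_def)
    have "\<not> fib e' (\<Inter>D0) \<subseteq> (\<Union>P\<in>PP - D0. fib e' P)"
    proof
      assume cov: "fib e' (\<Inter>D0) \<subseteq> (\<Union>P\<in>PP - D0. fib e' P)"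
      have "fib e (\<Inter>D0) \<subseteq> (\<Union>P\<in>PP - D0. fib e P)"
      proof (rule coset_cover_cong[OF _ _ _ _ _ _ _ cov])
        show "finite (PP - D0)"
          using fin by simp
        show "is_subgroup (fib 0 (\<Inter>D0))"
          unfolding fib_def by (rule subgroup_fibre[OF sD0])
        show "empty_or_coset (fib 0 (\<Inter>D0)) (fib e' (\<Inter>D0))" "empty_or_coset (fib 0 (\<Inter>D0)) (fib e (\<Inter>D0))"
          unfolding fib_def by (rule empty_or_coset_fibre[OF sD0])+
        show "is_subgroup (fib 0 P)" if "P \<in> PP - D0" for P
          unfolding fib_def using that sub by (intro subgroup_fibre) auto
        show "empty_or_coset (fib 0 P) (fib e' P) \<and> empty_or_coset (fib 0 P) (fib e P)"
          if "P \<in> PP - D0" for P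
          unfolding fib_def using that sub by (intro conjI empty_or_coset_fibre) auto
        show "fib e' (\<Inter>D0) \<inter> (\<Inter>P\<in>D. fib e' P) = {} \<longleftrightarrow> fib e (\<Inter>D0) \<inter> (\<Inter>P\<in>D. fib e P) = {}"
          if "D \<subseteq> PP - D0" for D
        proof -
          have "D0 \<union> D \<subseteq> PP"
            using that by (auto simp: D0_def)
          from fib_empty[OF this] show ?thesis
            by (simp add: fib_Inter INF_union)
        qed
      qed
      moreover have "a \<in> fib e (\<Inter>D0)"
        by (auto simp: fib_def D0_def)
      ultimately obtain P where "P \<in> PP - D0" "a \<in> fib e P"
        by blast
      then show False
        by (auto simp: fib_def D0_def)
    qed
    then obtain a' where a': "a' \<in> fib e' (\<Inter>D0)" "\<And>P. P \<in> PP - D0 \<Longrightarrow> a' \<notin> fib e' P"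
      by blast
    have "\<forall>P\<in>PP. e(v := a) \<in> P \<longleftrightarrow> e'(v := a') \<in> P"
    proof
      fix P assume P: "P \<in> PP"
      show "e(v := a) \<in> P \<longleftrightarrow> e'(v := a') \<in> P"
        using a'(1) a'(2)[of P] P by (cases "P \<in> D0") (auto simp: fib_def D0_def)
    qed
    then have "e'(v := a') \<in> Y"
      using det a unfolding determined_def by blast
    then show ?thesis ..
  qed
  show ?thesis
    unfolding determined_def
  proof (intro allI impI)
    fix e e' :: "'v \<Rightarrow> 'a"
    assume ag: "\<forall>Q \<in> (\<lambda>D. proj v (\<Inter>D)) ` Pow PP. e \<in> Q \<longleftrightarrow> e' \<in> Q"
    then have ag': "\<forall>Q \<in> (\<lambda>D. proj v (\<Inter>D)) ` Pow PP. e' \<in> Q \<longleftrightarrow> e \<in> Q"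
      by simp
    show "e \<in> {e. \<exists>a. e(v := a) \<in> Y} \<longleftrightarrow> e' \<in> {e. \<exists>a. e(v := a) \<in> Y}"
      using *[OF ag] *[OF ag'] by blast
  qed
qed

theorem sat_determined:
  assumes fe: "finite_exponent TYPE('a::ab_group_add)"
  shows "\<exists>PP. finite PP \<and> (\<forall>P\<in>PP. invariant P) \<and> determined PP {e :: nat \<Rightarrow> 'a. sat e \<phi>}"
proof (induction \<phi>)
  case (Eql s t)
  show ?case
    using invariant_equation[OF fe, of s t]
    by (intro exI[of _ "{{e. tval e s = tval e t}}"]) (auto simp: determined_def)
next
  case (Neg f)
  then show ?case
    by (auto simp: determined_def)
next
  case (Conj f g)
  then obtain P Q where P: "finite P" "\<forall>X\<in>P. invariant X" "determined P {e :: nat \<Rightarrow> 'a. sat e f}"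
    and Q: "finite Q" "\<forall>X\<in>Q. invariant X" "determined Q {e :: nat \<Rightarrow> 'a. sat e g}"
    by blast
  have "determined (P \<union> Q) {e :: nat \<Rightarrow> 'a. sat e (Conj f g)}"
    unfolding determined_def
  proof (intro allI impI)
    fix e e' :: "nat \<Rightarrow> 'a"
    assume "\<forall>X\<in>P \<union> Q. e \<in> X \<longleftrightarrow> e' \<in> X"
    then have "sat e f \<longleftrightarrow> sat e' f" "sat e g \<longleftrightarrow> sat e' g"
      using P(3) Q(3) unfolding determined_def by simp_all
    then show "e \<in> {e. sat e (Conj f g)} \<longleftrightarrow> e' \<in> {e. sat e (Conj f g)}"
      by simp
  qed
  then show ?case
    using P Q by (intro exI[of _ "P \<union> Q"]) auto
next
  case (Exi v f)
  then obtain PP where PP: "finite PP" "\<And>P. P \<in> PP \<Longrightarrow> invariant P"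
      "determined PP {e :: nat \<Rightarrow> 'a. sat e f}"
    by blast
  have "invariant (proj v (\<Inter>D))" if "D \<subseteq> PP" for D
    using invariant_INT[of D "\<lambda>P. P"] PP(2) that by (intro invariant_proj[OF fe]) auto
  moreover have "determined ((\<lambda>D. proj v (\<Inter>D)) ` Pow PP) {e. \<exists>a. e(v := a) \<in> {e. sat e f}}"
    using PP by (intro determined_exists) (auto intro: invariant_subgroup)
  ultimately show ?case
    using PP(1) by (intro exI[of _ "(\<lambda>D. proj v (\<Inter>D)) ` Pow PP"]) auto
qed


section \<open>Height-closed subgroups up to finite index\<close>

text \<open>A comparison of Ulm sequences at all primes: it says that the multiples of the pair
  \<open>(a, b)\<close> do not decrease heights.\<close>

definition height_le :: "'a::ab_group_add \<Rightarrow> 'a \<Rightarrow> bool" where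
  "height_le a b \<longleftrightarrow>
     (\<forall>k q l. prime q \<longrightarrow> nmul k a \<in> multiples (q ^ l) \<longrightarrow> nmul k b \<in> multiples (q ^ l))"

definition height_closed :: "'a::ab_group_add set \<Rightarrow> bool" where
  "height_closed G \<longleftrightarrow> is_subgroup G \<and> (\<forall>a\<in>G. \<forall>b. height_le a b \<longrightarrow> b \<in> G)"

lemma height_closed_subgroup: "height_closed G \<Longrightarrow> is_subgroup G"
  by (simp add: height_closed_def)

lemma height_closed_INT:
  "(\<And>i. i \<in> I \<Longrightarrow> height_closed (K i)) \<Longrightarrow> height_closed (\<Inter>i\<in>I. K i)"
  unfolding height_closed_def by (auto intro!: subgroup_INT)

text \<open>The multiples of \<open>(a, b)\<close> form a height-nondecreasing relation that
  contains \<open>(0, 0)\<close>, so it acts at the coordinate \<open>v\<close> and fixes the zeros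
  elsewhere.\<close>

lemma height_closed_fibre:
  fixes P :: "('v \<Rightarrow> 'a::ab_group_add) set"
  assumes fe: "finite_exponent TYPE('a)" and P: "invariant P"
  shows "height_closed {a. 0(v := a) \<in> P}"
  unfolding height_closed_def
proof (intro conjI ballI allI impI)
  show "is_subgroup {a. 0(v := a) \<in> P}"
    by (rule subgroup_fibre[OF invariant_subgroup[OF P]])
  fix a b assume a: "a \<in> {a. 0(v := a) \<in> P}" and ab: "height_le a b"
  obtain N where N: "N > 0" "\<And>a::'a. nmul N a = 0"
    using fe by (rule finite_exponentE) blast
  define R where "R = range (\<lambda>k. (nmul k a, nmul k b))"
  have R: "(nmul k a, nmul k b) \<in> R" for k
    unfolding R_def by blast
  have "is_subgroup R"
  proof (rule subgroup_if_closed_add[OF N(1)])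
    show "nmul N x = 0" for x :: "'a \<times> 'a"
      using N(2) by (cases x) (simp add: nmul_Pair zero_prod_def)
    show "0 \<in> R"
      using R[of 0] by (simp add: zero_prod_def)
    fix x y assume "x \<in> R" "y \<in> R"
    then obtain k l where "x = (nmul k a, nmul k b)" "y = (nmul l a, nmul l b)"
      unfolding R_def by blast
    then show "x + y \<in> R"
      using R[of "k + l"] by (simp add: nmul_add_left)
  qed
  then have hR: "height_rel R"
    using ab unfolding height_rel_def height_le_def by (auto simp: R_def)
  have "((0(v := a)) w, (0(v := b)) w) \<in> R" for w
    using R[of 0] R[of 1] by simp
  then show "b \<in> {a. 0(v := a) \<in> P}"
    using P a hR unfolding invariant_def by blast
qed

text \<open>Away from \<open>p\<close> the torsion element \<open>b\<close> has infinite height, and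
  multipliers prime to \<open>p\<close> can be cancelled. What remains is to separate the heights of
  \<open>nmul (p ^ l) a\<close> and \<open>nmul (p ^ l) b\<close> by some \<open>c\<close>.\<close>

lemma height_le_torsionI:
  assumes p: "prime p" and b: "nmul (p ^ n) b = 0"
    and le: "\<And>l. nmul (p ^ l) b = 0 \<or>
      (\<exists>c. nmul (p ^ l) b \<in> multiples (p ^ c) \<and> nmul (p ^ l) a \<notin> multiples (p ^ Suc c))"
  shows "height_le a b"
  unfolding height_le_def
proof (intro allI impI)
  fix k q l assume q: "prime q" and ka: "nmul k a \<in> multiples (q ^ l)"
  show "nmul k b \<in> multiples (q ^ l)"
  proof (cases "q = p")
    case False
    then have "coprime (p ^ n) (q ^ l)"
      using p q by (simp add: primes_coprime)
    moreover have "nmul (p ^ n) b \<in> multiples (q ^ l)"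
      using b subgroup_zero[OF subgroup_multiples] by simp
    ultimately have "b \<in> multiples (q ^ l)"
      by (rule multiples_cancel_coprime)
    then show ?thesis
      by (rule subgroup_nmul[OF subgroup_multiples])
  next
    case qp: True
    show ?thesis
    proof (cases "k = 0")
      case True
      then show ?thesis
        using subgroup_zero[OF subgroup_multiples] by simp
    next
      case False
      then obtain m j where k: "k = m * p ^ j" "coprime m p"
        using prime_power_splitE[of k p] p by blast
      have "coprime m (p ^ l)"
        using k by simp
      then have ja: "nmul (p ^ j) a \<in> multiples (p ^ l)"
        using multiples_cancel_coprime[of m "p ^ l" "nmul (p ^ j) a"] ka by (simp add: k qp nmul_mult)
      have "nmul (p ^ j) b \<in> multiples (p ^ l)"
        using le[of j]
      proof
        assume "\<exists>c. nmul (p ^ j) b \<in> multiples (p ^ c) \<and> nmul (p ^ j) a \<notin> multiples (p ^ Suc c)"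
        then obtain c where c: "nmul (p ^ j) b \<in> multiples (p ^ c)"
            "nmul (p ^ j) a \<notin> multiples (p ^ Suc c)"
          by blast
        have "l \<le> c"
        proof (rule ccontr)
          assume "\<not> l \<le> c"
          then have "multiples (p ^ l) \<subseteq> (multiples (p ^ Suc c) :: 'a set)"
            by (intro multiples_power_mono) simp
          then show False
            using ja c(2) by blast
        qed
        then show ?thesis
          using c(1) multiples_power_mono[of l c p] by blast
      qed (simp add: subgroup_zero[OF subgroup_multiples])
      then show ?thesis
        using subgroup_nmul[OF subgroup_multiples, of "nmul (p ^ j) b" "p ^ l" m]
        by (simp add: k qp nmul_mult)
    qed
  qed
qed

text \<open>\<open>pure_gen p i e\<close>: the element \<open>e\<close> generates a pure subgroup of order \<open>p\<^bsup>i+1\<^esup>\<close>, that is, a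
  cyclic direct summand. Such elements replace a decomposition of the group into cyclic groups.\<close>

definition pure_gen :: "nat \<Rightarrow> nat \<Rightarrow> 'a::ab_group_add \<Rightarrow> bool" where
  "pure_gen p i e \<longleftrightarrow> nmul (p ^ Suc i) e = 0 \<and> nmul (p ^ i) e \<notin> multiples (p ^ Suc i)"

lemma nmul_power_add: "nmul (p ^ k) (nmul (p ^ l) a) = nmul (p ^ (k + l)) a"
  by (simp add: power_add nmul_mult)

lemma nmul_power_in_multiples:
  assumes "nmul (p ^ l) a \<in> multiples (p ^ c)"
  shows "nmul (p ^ (k + l)) a \<in> multiples (p ^ (k + c))"
  using nmul_in_multiples[OF assms, of "p ^ k"] by (simp add: power_add nmul_mult)

lemma nmul_power_self: "nmul (p ^ l) a \<in> multiples (p ^ l)"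
  by (simp add: multiples_def)

lemma pure_gen_height:
  assumes "pure_gen p i e" "l \<le> i"
  shows "nmul (p ^ l) e \<notin> multiples (p ^ Suc l)"
proof
  assume "nmul (p ^ l) e \<in> multiples (p ^ Suc l)"
  then have "nmul (p ^ (i - l + l)) e \<in> multiples (p ^ (i - l + Suc l))"
    by (rule nmul_power_in_multiples)
  then show False
    using assms by (simp add: pure_gen_def)
qed

lemma nmul_power_eq_0:
  assumes "nmul (p ^ k) e = 0" "k \<le> l"
  shows "nmul (p ^ l) e = 0"
  using nmul_power_add[of p "l - k" k e] assms by simp

text \<open>The nonzero multiples \<open>nmul (p ^ l) e\<close> have \<open>p\<close>-height exactly
  \<open>l\<close>. So \<open>j \<le> j'\<close> compares heights and
  \<open>i' + j \<le> i + j'\<close> compares orders; the latter is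
  \<open>i' - j' \<le> i - j\<close> written without truncated subtraction.\<close>

lemma height_closed_pure_gen:
  assumes G: "height_closed G" and p: "prime p"
    and e: "pure_gen p i e" and e': "pure_gen p i' e'"
    and "nmul (p ^ j) e \<in> G" "j \<le> j'" "i' + j \<le> i + j'"
  shows "nmul (p ^ j') e' \<in> G"
proof -
  have "height_le (nmul (p ^ j) e) (nmul (p ^ j') e')"
  proof (rule height_le_torsionI[OF p, where n = "Suc i'"])
    show "nmul (p ^ Suc i') (nmul (p ^ j') e') = 0"
      using e' nmul_commute[of "p ^ Suc i'" "p ^ j'" e'] unfolding pure_gen_def by simp
    fix l
    show "nmul (p ^ l) (nmul (p ^ j') e') = 0 \<or>
      (\<exists>c. nmul (p ^ l) (nmul (p ^ j') e') \<in> multiples (p ^ c) \<and>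
           nmul (p ^ l) (nmul (p ^ j) e) \<notin> multiples (p ^ Suc c))"
    proof (cases "l + j' \<le> i'")
      case True
      have "nmul (p ^ (l + j)) e \<notin> multiples (p ^ Suc (l + j))"
        by (rule pure_gen_height[OF e]) (use True assms in linarith)
      then have "nmul (p ^ (l + j)) e \<notin> multiples (p ^ Suc (l + j'))"
        using multiples_power_mono[of "Suc (l + j)" "Suc (l + j')" p] assms(6) by auto
      then show ?thesis
        unfolding nmul_power_add using nmul_power_self by blast
    next
      case False
      then show ?thesis
        using e' nmul_power_eq_0[of p "Suc i'" e' "l + j'"]
        by (simp add: nmul_power_add pure_gen_def)
    qed
  qed
  then show ?thesis
    using G assms(5) unfolding height_closed_def by blast
qed

section \<open>Finite index detected on pure generators\<close>

lemma subgroup_divisible_torsion: "is_subgroup (divisible_torsion p i :: 'a::ab_group_add set)"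
proof -
  have "divisible_torsion p i = {a::'a. nmul p a = 0} \<inter> multiples (p ^ i)"
    by (auto simp: divisible_torsion_def multiples_def)
  moreover have "is_subgroup {a::'a. nmul p a = 0}"
    by (auto simp: is_subgroup_def nmul_diff)
  ultimately show ?thesis
    by (simp add: subgroup_Int subgroup_multiples)
qed

text \<open>Within the elements killed by \<open>p ^ Suc k\<close>, filter by the height of
  \<open>nmul (p ^ k) x\<close> and descend from \<open>L\<close>. A layer with finite Ulm invariant
  contributes finite index. In a layer with infinite Ulm invariant, a multiple of a pure generator,
  lying in \<open>G\<close> by hypothesis, moves \<open>x\<close> to a higher layer.\<close>

lemma fin_index_primary:
  fixes G G' :: "'a::ab_group_add set"
  assumes fe: "finite_exponent TYPE('a)" and p: "prime p"
    and G': "height_closed G'" and G: "is_subgroup G"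
    and gen: "\<And>i j e. i \<in> ulm_inf TYPE('a) p \<Longrightarrow> pure_gen p i e \<Longrightarrow>
      nmul (p ^ j) e \<in> G' \<Longrightarrow> nmul (p ^ j) e \<in> G"
  shows "fin_index {x \<in> G'. nmul (p ^ k) x = 0} G"
proof (induction k)
  case 0
  have "{x \<in> G'. nmul (p ^ 0) x = 0} \<subseteq> {0}"
    by auto
  then have "finite {x \<in> G'. nmul (p ^ 0) x = 0}"
    by (rule finite_subset) simp
  then show ?case
    by (simp add: fin_index_def)
next
  case (Suc k)
  obtain L where L: "\<And>a::'a. a \<in> multiples (p ^ L) \<Longrightarrow> nmul p a = 0 \<Longrightarrow> a = 0"
    by (rule multiples_stable[OF fe p]) (rule that)
  note sG' = height_closed_subgroup[OF G']
  define X where "X i = {x \<in> G'. nmul (p ^ Suc k) x = 0 \<and> nmul (p ^ k) x \<in> multiples (p ^ i)}" for i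
  have sX: "is_subgroup (X i)" for i
    using subgroup_zero[OF sG'] subgroup_diff[OF sG'] subgroup_zero[OF subgroup_multiples]
      subgroup_diff[OF subgroup_multiples] unfolding is_subgroup_def X_def
    by (auto simp: nmul_diff simp del: power_Suc)
  have "fin_index (X 0) G"
  proof (rule inc_induct[of 0 L "\<lambda>i. fin_index (X i) G"])
    \<comment> \<open>In the top layer \<open>nmul (p ^ k) x\<close> is \<open>p\<close>-torsion of
      infinite height, hence 0, and the outer induction on \<open>k\<close> applies.\<close>
    have "X L \<subseteq> {x \<in> G'. nmul (p ^ k) x = 0}"
      using L by (auto simp: X_def nmul_mult)
    then show "fin_index (X L) G"
      using Suc.IH by (rule fin_index_mono[rotated])
    fix i assume IH: "fin_index (X (Suc i)) G"
    show "fin_index (X i) G"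
    proof (cases "i \<in> ulm_inf TYPE('a) p")
      case False
      have "fin_index (X i) (X (Suc i))"
      proof (rule fin_indexI[OF sX, where f = "\<lambda>x. coset (divisible_torsion p (Suc i)) (nmul (p ^ k) x)"])
        have "finite (coset (divisible_torsion p (Suc i)) ` (divisible_torsion p i :: 'a set))"
          using False unfolding ulm_inf_def ulm_quotient_def coset_def by simp
        moreover have "(\<lambda>x. coset (divisible_torsion p (Suc i)) (nmul (p ^ k) x)) ` X i
            \<subseteq> coset (divisible_torsion p (Suc i)) ` divisible_torsion p i"
          by (auto simp: X_def divisible_torsion_def multiples_def nmul_mult)
        ultimately show "finite ((\<lambda>x. coset (divisible_torsion p (Suc i)) (nmul (p ^ k) x)) ` X i)"
          by (rule finite_subset[rotated])
        fix a b assume ab: "a \<in> X i" "b \<in> X i"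
          and "coset (divisible_torsion p (Suc i)) (nmul (p ^ k) a)
             = coset (divisible_torsion p (Suc i)) (nmul (p ^ k) b)"
        then have "nmul (p ^ k) (a - b) \<in> divisible_torsion p (Suc i)"
          unfolding nmul_diff using coset_eq[OF subgroup_divisible_torsion] by metis
        then have "nmul (p ^ k) (a - b) \<in> multiples (p ^ Suc i)"
          unfolding divisible_torsion_def multiples_def by blast
        then show "a - b \<in> X (Suc i)"
          using subgroup_diff[OF sX ab] by (simp add: X_def)
      qed
      then show ?thesis
        using fin_index_trans[OF sX G _ IH] by blast
    next
      case True
      obtain F where F: "finite F" "X (Suc i) \<subseteq> (\<Union>t\<in>F. coset G t)"
        using IH fin_index_iff_cover[OF G] by blast
      have "x \<in> (\<Union>t\<in>F. coset G t)" if x: "x \<in> X i" for x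
      proof (cases "x \<in> X (Suc i)")
        case True
        then show ?thesis
          using F(2) by blast
      next
        case False
        then have ht: "nmul (p ^ k) x \<notin> multiples (p ^ Suc i)"
          using x by (simp add: X_def)
        obtain e where e: "nmul (p ^ k) x = nmul (p ^ i) e"
          using x by (auto simp: X_def multiples_def)
        have ki: "k \<le> i"
        proof (rule ccontr)
          assume "\<not> k \<le> i"
          then have "multiples (p ^ k) \<subseteq> (multiples (p ^ Suc i) :: 'a set)"
            by (intro multiples_power_mono) simp
          then show False
            using ht nmul_power_self by blast
        qed
        have e0: "nmul (p ^ Suc i) e = 0"
          using x e nmul_mult[of p "p ^ i" e] nmul_mult[of p "p ^ k" x] by (simp add: X_def)
        then have gen_e: "pure_gen p i e"
          using ht e by (simp add: pure_gen_def)
        \<comment> \<open>This \<open>u\<close> agrees with \<open>x\<close> after multiplication by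
          \<open>p ^ k\<close> and has heights at least those of \<open>x\<close>, so it stays in
          \<open>G'\<close>.\<close>
        define u where "u = nmul (p ^ (i - k)) e"
        have "height_le x u"
        proof (rule height_le_torsionI[OF p, where n = "Suc k"])
          show "nmul (p ^ Suc k) u = 0"
            unfolding u_def nmul_power_add using e0 ki by simp
          fix l
          show "nmul (p ^ l) u = 0 \<or> (\<exists>c. nmul (p ^ l) u \<in> multiples (p ^ c) \<and>
              nmul (p ^ l) x \<notin> multiples (p ^ Suc c))"
          proof (cases "l \<le> k")
            case True
            have "nmul (p ^ l) x \<notin> multiples (p ^ Suc (l + (i - k)))"
            proof
              assume "nmul (p ^ l) x \<in> multiples (p ^ Suc (l + (i - k)))"
              then have "nmul (p ^ (k - l + l)) x \<in> multiples (p ^ (k - l + Suc (l + (i - k))))"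
                by (rule nmul_power_in_multiples)
              then show False
                using ht True ki by simp
            qed
            then show ?thesis
              unfolding u_def nmul_power_add using nmul_power_self by blast
          next
            case False
            then show ?thesis
              unfolding u_def nmul_power_add using nmul_power_eq_0[OF e0, of "l + (i - k)"] ki by simp
          qed
        qed
        then have uG': "u \<in> G'"
          using G' x unfolding height_closed_def by (auto simp: X_def)
        then have uG: "u \<in> G"
          using gen[OF \<open>i \<in> ulm_inf TYPE('a) p\<close> gen_e] by (simp add: u_def)
        have "nmul (p ^ k) u = nmul (p ^ k) x"
          unfolding u_def nmul_power_add using ki e by simp
        then have "nmul (p ^ k) (x - u) = 0" "nmul (p ^ Suc k) (x - u) = 0"
          by (simp_all add: nmul_diff nmul_mult)
        then have "x - u \<in> X (Suc i)"
          using subgroup_diff[OF sG' _ uG'] x subgroup_zero[OF subgroup_multiples]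
          by (simp add: X_def)
        then obtain t where t: "t \<in> F" "x - u - t \<in> G"
          using F(2) by (auto simp: mem_coset subset_iff)
        have "x - t \<in> G"
          using subgroup_add[OF G t(2) uG] by (simp add: algebra_simps)
        then show ?thesis
          using t(1) by (auto simp: mem_coset)
      qed
      then show ?thesis
        using F(1) fin_index_iff_cover[OF G] by blast
    qed
  qed simp
  then show ?case
    by (simp add: X_def)
qed

lemma fin_index_sum:
  assumes G: "is_subgroup G" and "fin_index A G" "fin_index B G"
    and "\<And>c. c \<in> C \<Longrightarrow> \<exists>a\<in>A. \<exists>b\<in>B. c = a + b"
  shows "fin_index C G"
proof -
  obtain F where F: "finite F" "A \<subseteq> (\<Union>t\<in>F. coset G t)"
    using assms(2) fin_index_iff_cover[OF G] by blast
  obtain F' where F': "finite F'" "B \<subseteq> (\<Union>t\<in>F'. coset G t)"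
    using assms(3) fin_index_iff_cover[OF G] by blast
  have "C \<subseteq> (\<Union>t\<in>(\<lambda>(a, b). a + b) ` (F \<times> F'). coset G t)"
  proof
    fix c assume "c \<in> C"
    then obtain a b where ab: "a \<in> A" "b \<in> B" "c = a + b"
      using assms(4) by blast
    obtain s t where st: "s \<in> F" "a - s \<in> G" "t \<in> F'" "b - t \<in> G"
      using subsetD[OF F(2) ab(1)] subsetD[OF F'(2) ab(2)] by (auto simp: mem_coset)
    have "c - (s + t) \<in> G"
      using subgroup_add[OF G st(2,4)] by (simp add: ab algebra_simps)
    then show "c \<in> (\<Union>t\<in>(\<lambda>(a, b). a + b) ` (F \<times> F'). coset G t)"
      using st by (force simp: mem_coset)
  qed
  moreover have "finite ((\<lambda>(a, b). a + b) ` (F \<times> F'))"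
    using F F' by auto
  ultimately show ?thesis
    using fin_index_iff_cover[OF G] by blast
qed

text \<open>The primary decomposition of \<open>G'\<close>, one prime power of \<open>M\<close> at a
  time, reduces the claim to \<open>fin_index_primary\<close>.\<close>

lemma fin_index_height_closed:
  fixes G G' :: "'a::ab_group_add set"
  assumes fe: "finite_exponent TYPE('a)" and G': "height_closed G'" and G: "is_subgroup G"
    and gen: "\<And>p i j e. prime p \<Longrightarrow> i \<in> ulm_inf TYPE('a) p \<Longrightarrow> pure_gen p i e \<Longrightarrow>
      nmul (p ^ j) e \<in> G' \<Longrightarrow> nmul (p ^ j) e \<in> G"
  shows "fin_index G' G"
proof -
  note sG' = height_closed_subgroup[OF G']
  have *: "fin_index {x \<in> G'. nmul M x = 0} G" if "M > 0" for M
    using that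
  proof (induction M rule: less_induct)
    case (less M)
    show ?case
    proof (cases "M = 1")
      case True
      have "{x \<in> G'. nmul M x = 0} \<subseteq> {0}"
        using True by auto
      then have "finite {x \<in> G'. nmul M x = 0}"
        by (rule finite_subset) simp
      then show ?thesis
        by (simp add: fin_index_def)
    next
      case False
      then obtain p where p: "prime p" "p dvd M"
        using prime_factor_nat by blast
      obtain m k where mk: "M = m * p ^ k" "coprime m p" "m > 0"
        using prime_power_splitE[OF less.prems p(1)] .
      have "k \<noteq> 0"
        using mk p not_prime_unit[of p] by (cases k) (auto simp: coprime_absorb_right)
      then have "m < M"
        using mk one_less_power[OF prime_gt_1_nat[OF p(1)], of k] by simp
      then have 1: "fin_index {x \<in> G'. nmul m x = 0} G"
        using less.IH mk(3) by blast
      have 2: "fin_index {x \<in> G'. nmul (p ^ k) x = 0} G"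
        using gen[OF p(1)] by (intro fin_index_primary[OF fe p(1) G' G]) blast
      have "coprime m (p ^ k)"
        using mk by simp
      then obtain u v where uv: "m * u = p ^ k * v + 1"
        using bezout_nat[of m "p ^ k"] mk(3) by auto
      show ?thesis
      proof (rule fin_index_sum[OF G 1 2])
        fix x assume "x \<in> {x \<in> G'. nmul M x = 0}"
        then have x: "x \<in> G'" "nmul (m * p ^ k) x = 0"
          by (auto simp: mk)
        \<comment> \<open>The Bezout relation writes \<open>x\<close> as its components killed by
          \<open>m\<close> and by \<open>p ^ k\<close>.\<close>
        let ?a = "- nmul (p ^ k * v) x" and ?b = "nmul (m * u) x"
        have "nmul m (nmul (p ^ k * v) x) = nmul v (nmul (m * p ^ k) x)"
          "nmul (p ^ k) (nmul (m * u) x) = nmul u (nmul (m * p ^ k) x)"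
          unfolding nmul_mult[symmetric] by (simp_all add: ac_simps)
        then have "nmul m ?a = 0" "nmul (p ^ k) ?b = 0"
          using x(2) by (simp_all add: nmul_uminus)
        moreover have "?a \<in> G'" "?b \<in> G'"
          using x(1) by (simp_all add: subgroup_uminus[OF sG'] subgroup_nmul[OF sG'])
        moreover have "x = ?a + ?b"
          unfolding uv nmul_add_left by simp
        ultimately show "\<exists>a\<in>{x \<in> G'. nmul m x = 0}. \<exists>b\<in>{x \<in> G'. nmul (p ^ k) x = 0}. x = a + b"
          by blast
      qed
    qed
  qed
  obtain N where N: "N > 0" "\<And>a::'a. nmul N a = 0"
    using fe by (rule finite_exponentE) blast
  show ?thesis
    using *[OF N(1)] N(2) by simp
qed

text \<open>In a minimal subfamily \<open>J\<close> with the same intersection on pure generators, every \<open>x \<in> J\<close> has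
  a private Ulm index \<open>u x\<close>, at which \<open>K x\<close> is strictly smaller than all the other groups. Two
  private indices are never equal or consecutive.\<close>

lemma pure_gen_subfamily:
  fixes K :: "'i \<Rightarrow> 'a::ab_group_add set"
  assumes fe: "finite_exponent TYPE('a)" and p: "prime p" and I: "finite I"
    and K: "\<And>x. x \<in> I \<Longrightarrow> height_closed (K x)"
  obtains J where "J \<subseteq> I" "card J \<le> min (ulm_n TYPE('a) p) (ulm_m TYPE('a) p div 2 + 1)"
    "\<And>i j e. i \<in> ulm_inf TYPE('a) p \<Longrightarrow> pure_gen p i e \<Longrightarrow>
      nmul (p ^ j) e \<in> (\<Inter>x\<in>J. K x) \<Longrightarrow> nmul (p ^ j) e \<in> (\<Inter>x\<in>I. K x)"
proof -
  let ?U = "ulm_inf TYPE('a) p"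
  define Q where "Q J \<longleftrightarrow> (\<forall>i j e. i \<in> ?U \<longrightarrow> pure_gen p i e \<longrightarrow>
      nmul (p ^ j) e \<in> (\<Inter>x\<in>J. K x) \<longrightarrow> nmul (p ^ j) e \<in> (\<Inter>x\<in>I. K x))" for J
  have "I \<subseteq> I \<and> Q I"
    by (auto simp: Q_def)
  then obtain J where J: "J \<subseteq> I" "Q J" and least: "\<And>J'. J' \<subseteq> I \<Longrightarrow> Q J' \<Longrightarrow> card J \<le> card J'"
    using ex_has_least_nat[of "\<lambda>J. J \<subseteq> I \<and> Q J" I card] by blast
  have finJ: "finite J"
    using J(1) I finite_subset by blast
  have "\<exists>i j e. i \<in> ?U \<and> pure_gen p i e \<and> nmul (p ^ j) e \<notin> K x
      \<and> (\<forall>y\<in>J - {x}. nmul (p ^ j) e \<in> K y)" if x: "x \<in> J" for x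
  proof -
    have "card (J - {x}) < card J"
      using finJ x by (rule card_Diff1_less)
    then have "\<not> Q (J - {x})"
      using least[of "J - {x}"] J(1) by auto
    then obtain i j e where ije: "i \<in> ?U" "pure_gen p i e" "nmul (p ^ j) e \<in> (\<Inter>y\<in>J - {x}. K y)"
        "nmul (p ^ j) e \<notin> (\<Inter>y\<in>I. K y)"
      unfolding Q_def by blast
    then have "nmul (p ^ j) e \<notin> (\<Inter>y\<in>J. K y)"
      using J(2) unfolding Q_def by blast
    with ije show ?thesis
      by blast
  qed
  then obtain u j e where priv: "\<And>x. x \<in> J \<Longrightarrow> u x \<in> ?U" "\<And>x. x \<in> J \<Longrightarrow> pure_gen p (u x) (e x)"
      "\<And>x. x \<in> J \<Longrightarrow> nmul (p ^ j x) (e x) \<notin> K x"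
      "\<And>x y. x \<in> J \<Longrightarrow> y \<in> J \<Longrightarrow> y \<noteq> x \<Longrightarrow> nmul (p ^ j x) (e x) \<in> K y"
    by (metis Diff_iff singletonD)
  have K': "height_closed (K x)" if "x \<in> J" for x
    using that J(1) K by blast
  \<comment> \<open>At a common index, the smaller exponent \<open>j x\<close> forces the private
    element of \<open>y\<close> into \<open>K y\<close>.\<close>
  have neq: "u x \<noteq> u y" if xy: "x \<in> J" "y \<in> J" "x \<noteq> y" "j x \<le> j y" for x y
  proof
    assume eq: "u x = u y"
    have "nmul (p ^ j y) (e y) \<in> K y"
      using height_closed_pure_gen[OF K'[OF xy(2)] p priv(2)[OF xy(1)] priv(2)[OF xy(2)]
          priv(4)[OF xy(1,2)]] xy(3,4) eq by simp
    then show False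
      using priv(3)[OF xy(2)] by blast
  qed
  have inj: "inj_on u J"
  proof (rule inj_onI, rule ccontr)
    fix x y assume "x \<in> J" "y \<in> J" "u x = u y" "x \<noteq> y"
    then show False
      using neq[of x y] neq[of y x] by (cases "j x \<le> j y") auto
  qed
  \<comment> \<open>If \<open>j y \<le> j x\<close>, the element of \<open>y\<close> forces that of
    \<open>x\<close> into \<open>K x\<close>. Otherwise \<open>j x + 1 \<le> j y\<close> compensates
    exactly the shift of the index by one, and the roles are exchanged.\<close>
  have not_Suc: "u y \<noteq> Suc (u x)" if xy: "x \<in> J" "y \<in> J" for x y
  proof
    assume eq: "u y = Suc (u x)"
    then have ne: "x \<noteq> y" by auto
    show False
    proof (cases "j y \<le> j x")
      case True
      have "nmul (p ^ j x) (e x) \<in> K x"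
        using height_closed_pure_gen[OF K'[OF xy(1)] p priv(2)[OF xy(2)] priv(2)[OF xy(1)]
            priv(4)[OF xy(2,1)]] ne True eq by simp
      then show False
        using priv(3)[OF xy(1)] by blast
    next
      case False
      then have "nmul (p ^ j y) (e y) \<in> K y"
        using height_closed_pure_gen[OF K'[OF xy(2)] p priv(2)[OF xy(1)] priv(2)[OF xy(2)]
            priv(4)[OF xy(1,2)]] ne eq by simp
      then show False
        using priv(3)[OF xy(2)] by blast
    qed
  qed
  have finU: "finite ?U"
    by (rule finite_ulm_inf[OF fe p])
  have "card J \<le> ulm_n TYPE('a) p"
    unfolding ulm_n_def by (rule card_inj_on_le[OF inj _ finU]) (use priv(1) in blast)
  moreover have "card J \<le> ulm_m TYPE('a) p div 2 + 1"
  proof -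
    \<comment> \<open>Indices with the same half are equal or consecutive, so halving remains
      injective and leaves \<open>ulm_m div 2 + 1\<close> possible values.\<close>
    have "inj_on (\<lambda>x. u x div 2) J"
    proof (rule inj_onI)
      fix x y assume xy: "x \<in> J" "y \<in> J" "u x div 2 = u y div 2"
      then have "u x = u y"
        using not_Suc[OF xy(1,2)] not_Suc[OF xy(2,1)] by presburger
      then show "x = y"
        using inj xy by (simp add: inj_on_eq_iff)
    qed
    moreover have "u x \<le> ulm_m TYPE('a) p" if "x \<in> J" for x
      using Max_ge[OF finU priv(1)[OF that]] priv(1)[OF that] by (auto simp: ulm_m_def)
    then have "(\<lambda>x. u x div 2) ` J \<subseteq> {..ulm_m TYPE('a) p div 2}"
      by (auto intro: div_le_mono)
    ultimately have "card J \<le> card {..ulm_m TYPE('a) p div 2}"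
      by (rule card_inj_on_le) simp
    then show ?thesis
      by simp
  qed
  ultimately show ?thesis
    using that[of J] J unfolding Q_def by auto
qed

text \<open>The subfamilies chosen for the single primes are united. Primes without infinite Ulm
  invariants impose no condition on pure generators.\<close>

lemma height_closed_subfamily:
  fixes K :: "'i \<Rightarrow> 'a::ab_group_add set"
  assumes fe: "finite_exponent TYPE('a)" and I: "finite I"
    and K: "\<And>x. x \<in> I \<Longrightarrow> height_closed (K x)"
  obtains J where "J \<subseteq> I" "card J \<le> ulm_d TYPE('a)" "fin_index (\<Inter>x\<in>J. K x) (\<Inter>x\<in>I. K x)"
proof -
  let ?S = "{p. prime p \<and> ulm_inf TYPE('a) p \<noteq> {}}"
  have "\<exists>J. J \<subseteq> I \<and> card J \<le> min (ulm_n TYPE('a) p) (ulm_m TYPE('a) p div 2 + 1) \<and>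
    (\<forall>i j e. i \<in> ulm_inf TYPE('a) p \<longrightarrow> pure_gen p i e \<longrightarrow>
      nmul (p ^ j) e \<in> (\<Inter>x\<in>J. K x) \<longrightarrow> nmul (p ^ j) e \<in> (\<Inter>x\<in>I. K x))" if p: "prime p" for p
    by (rule pure_gen_subfamily[OF fe p I K]) blast+
  then obtain J where J: "\<And>p. prime p \<Longrightarrow> J p \<subseteq> I"
      "\<And>p. prime p \<Longrightarrow> card (J p) \<le> min (ulm_n TYPE('a) p) (ulm_m TYPE('a) p div 2 + 1)"
      "\<And>p i j e. prime p \<Longrightarrow> i \<in> ulm_inf TYPE('a) p \<Longrightarrow> pure_gen p i e \<Longrightarrow>
        nmul (p ^ j) e \<in> (\<Inter>x\<in>J p. K x) \<Longrightarrow> nmul (p ^ j) e \<in> (\<Inter>x\<in>I. K x)"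
    by metis
  let ?J = "\<Union>p\<in>?S. J p"
  have sub: "?J \<subseteq> I"
    using J(1) by blast
  have "card ?J \<le> (\<Sum>p\<in>?S. card (J p))"
    by (rule card_UN_le[OF finite_ulm_primes[OF fe]])
  also have "\<dots> \<le> ulm_d TYPE('a)"
    unfolding ulm_d_def by (rule sum_mono) (use J(2) in blast)
  finally have card: "card ?J \<le> ulm_d TYPE('a)" .
  have "fin_index (\<Inter>x\<in>?J. K x) (\<Inter>x\<in>I. K x)"
  proof (rule fin_index_height_closed[OF fe])
    show "height_closed (\<Inter>x\<in>?J. K x)"
      using sub K by (intro height_closed_INT) blast
    show "is_subgroup (\<Inter>x\<in>I. K x)"
      using K by (intro subgroup_INT height_closed_subgroup)
    fix p i j e
    assume p: "prime p" "i \<in> ulm_inf TYPE('a) p" "pure_gen p i e" "nmul (p ^ j) e \<in> (\<Inter>x\<in>?J. K x)"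
    then have "p \<in> ?S"
      by blast
    then have "nmul (p ^ j) e \<in> (\<Inter>x\<in>J p. K x)"
      using p(4) by blast
    then show "nmul (p ^ j) e \<in> (\<Inter>x\<in>I. K x)"
      using J(3) p by blast
  qed
  with sub card show ?thesis
    by (rule that)
qed


section \<open>Invariant subgroups of a power up to finite index\<close>

text \<open>A copy of the power of \<open>A\<close> indexed by \<open>Y\<close> inside the total
  assignments.\<close>

definition supported :: "'v set \<Rightarrow> ('v \<Rightarrow> 'a::ab_group_add) set" where
  "supported Y = {e. \<forall>v. v \<notin> Y \<longrightarrow> e v = 0}"

lemma subgroup_supported: "is_subgroup (supported Y)"
  by (auto simp: is_subgroup_def supported_def)

text \<open>Induction on the number of coordinates: \<open>J1\<close> controls the fibres over 0 in
  direction \<open>v\<close>, and \<open>J2\<close> controls the projections along \<open>v\<close>.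
  Each new coordinate thus costs at most \<open>ulm_d\<close> further members.\<close>

lemma invariant_subfamily:
  fixes H :: "'i \<Rightarrow> ('v \<Rightarrow> 'a::ab_group_add) set"
  assumes fe: "finite_exponent TYPE('a)" and "finite Y" and I: "finite I"
    and "\<And>x. x \<in> I \<Longrightarrow> invariant (H x)"
  shows "\<exists>J\<subseteq>I. card J \<le> ulm_d TYPE('a) * card Y
      \<and> fin_index (supported Y \<inter> (\<Inter>x\<in>J. H x)) (\<Inter>x\<in>I. H x)"
  using assms(2,4)
proof (induction Y arbitrary: H rule: finite_induct)
  case empty
  have "supported {} = {0 :: 'v \<Rightarrow> 'a}"
    by (auto simp: supported_def)
  then show ?case
    by (intro exI[of _ "{}"]) (simp add: fin_index_def)
next
  case (insert v Y)
  have sH: "is_subgroup (H x)" if "x \<in> I" for x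
    using insert.prems[OF that] by (rule invariant_subgroup)
  define K where "K x = {a. 0(v := a) \<in> H x}" for x
  have hK: "height_closed (K x)" if "x \<in> I" for x
    unfolding K_def using insert.prems[OF that] by (rule height_closed_fibre[OF fe])
  obtain J1 where J1: "J1 \<subseteq> I" "card J1 \<le> ulm_d TYPE('a)" "fin_index (\<Inter>x\<in>J1. K x) (\<Inter>x\<in>I. K x)"
    by (rule height_closed_subfamily[OF fe I hK])
  define HJ where "HJ = (\<Inter>x\<in>J1. H x)"
  have HJ: "invariant HJ"
    unfolding HJ_def using J1(1) insert.prems by (intro invariant_INT) blast
  \<comment> \<open>Intersecting with \<open>HJ\<close> before projecting keeps the later
    corrections of the coordinate \<open>v\<close> inside \<open>HJ\<close>.\<close>
  define P where "P x = proj v (H x \<inter> HJ)" for x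
  have P: "invariant (P x)" if "x \<in> I" for x
    unfolding P_def by (intro invariant_proj[OF fe] invariant_Int HJ insert.prems that)
  obtain J2 where J2: "J2 \<subseteq> I" "card J2 \<le> ulm_d TYPE('a) * card Y"
      "fin_index (supported Y \<inter> (\<Inter>x\<in>J2. P x)) (\<Inter>x\<in>I. P x)"
    using insert.IH[of P] P by blast
  define J where "J = J1 \<union> J2"
  define M where "M = supported (insert v Y) \<inter> (\<Inter>x\<in>J. H x)"
  define Q where "Q = (\<Inter>x\<in>I. P x)"
  have sQ: "is_subgroup Q"
    unfolding Q_def using P by (intro subgroup_INT invariant_subgroup)
  have "is_subgroup (\<Inter>x\<in>J. H x)"
    using J1(1) J2(1) by (intro subgroup_INT sH) (auto simp: J_def)
  then have sM: "is_subgroup (M \<inter> Q)"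
    unfolding M_def by (intro subgroup_Int subgroup_supported sQ)
  have Q_upd: "e(v := a) \<in> Q \<longleftrightarrow> e \<in> Q" for e a
    by (simp add: Q_def P_def proj_def)
  have MJ: "e \<in> HJ" if "e \<in> M" for e
    using that by (auto simp: M_def HJ_def J_def)
  have "fin_index M (M \<inter> Q)"
  \<comment> \<open>Membership in \<open>Q\<close> ignores the coordinate \<open>v\<close>; setting
    it to 0 lands in \<open>supported Y\<close>, where the induction hypothesis counts
    cosets.\<close>
  proof (rule fin_indexI[OF sM, where f = "\<lambda>e. coset Q (e(v := 0))"])
    have "e(v := 0) \<in> supported Y \<inter> (\<Inter>x\<in>J2. P x)" if e: "e \<in> M" for e
    proof -
      have "(e(v := 0))(v := e v) \<in> H x \<inter> HJ" if "x \<in> J2" for x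
        using e MJ[OF e] that by (simp add: M_def J_def)
      then have "e(v := 0) \<in> P x" if "x \<in> J2" for x
        using that unfolding P_def proj_def by blast
      moreover have "e(v := 0) \<in> supported Y"
        using e by (auto simp: M_def supported_def)
      ultimately show ?thesis
        by blast
    qed
    then have "(\<lambda>e. coset Q (e(v := 0))) ` M \<subseteq> coset Q ` (supported Y \<inter> (\<Inter>x\<in>J2. P x))"
      by blast
    then show "finite ((\<lambda>e. coset Q (e(v := 0))) ` M)"
      using J2(3) unfolding fin_index_def Q_def[symmetric] by (rule finite_subset)
    fix a b assume ab: "a \<in> M" "b \<in> M" "coset Q (a(v := 0)) = coset Q (b(v := 0))"
    then have "a(v := 0) - b(v := 0) \<in> Q"
      using coset_eq[OF sQ] by blast
    then have "(a - b)(v := 0 - 0) \<in> Q"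
      by (simp only: fun_upd_diff)
    then have "a - b \<in> Q"
      by (simp only: Q_upd)
    moreover have "a - b \<in> M"
      using ab \<open>is_subgroup (\<Inter>x\<in>J. H x)\<close> unfolding M_def
      by (meson subgroup_Int subgroup_diff subgroup_supported)
    ultimately show "a - b \<in> M \<inter> Q"
      by blast
  qed
  moreover have "fin_index (M \<inter> Q) (\<Inter>x\<in>I. H x)"
  proof (rule fin_index_INT[OF I])
    fix x assume x: "x \<in> I"
    \<comment> \<open>\<open>c e\<close> is a value at \<open>v\<close> that brings \<open>e\<close>
      into \<open>H x \<inter> HJ\<close>. As \<open>e\<close> itself is in \<open>HJ\<close>, the
      error \<open>e v - c e\<close> lies in the fibre groups of \<open>J1\<close>, which meet
      finitely many cosets of the full intersection.\<close>
    define c where "c e = (SOME a. e(v := a) \<in> H x \<inter> HJ)" for e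
    have c: "e(v := c e) \<in> H x \<inter> HJ" if "e \<in> Q" for e
    proof -
      have "\<exists>a. e(v := a) \<in> H x \<inter> HJ"
        using that x by (auto simp: Q_def P_def proj_def)
      then show ?thesis
        unfolding c_def by (rule someI_ex)
    qed
    have sK: "is_subgroup (\<Inter>x\<in>I. K x)"
      using hK by (intro subgroup_INT height_closed_subgroup)
    show "fin_index (M \<inter> Q) (H x)"
    proof (rule fin_indexI[OF sH[OF x], where f = "\<lambda>e. coset (\<Inter>x\<in>I. K x) (e v - c e)"])
      have "e v - c e \<in> (\<Inter>x\<in>J1. K x)" if e: "e \<in> M \<inter> Q" for e
      proof -
        have "e(v := e v) - e(v := c e) \<in> HJ"
          using MJ[of e] c[of e] e subgroup_diff[OF invariant_subgroup[OF HJ]] by simp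
        then have "(e - e)(v := e v - c e) \<in> HJ"
          by (simp only: fun_upd_diff)
        then show ?thesis
          by (simp add: HJ_def K_def)
      qed
      then have "(\<lambda>e. coset (\<Inter>x\<in>I. K x) (e v - c e)) ` (M \<inter> Q)
          \<subseteq> coset (\<Inter>x\<in>I. K x) ` (\<Inter>x\<in>J1. K x)"
        by blast
      then show "finite ((\<lambda>e. coset (\<Inter>x\<in>I. K x) (e v - c e)) ` (M \<inter> Q))"
        using J1(3) unfolding fin_index_def by (rule finite_subset)
      fix a b assume ab: "a \<in> M \<inter> Q" "b \<in> M \<inter> Q"
        and "coset (\<Inter>x\<in>I. K x) (a v - c a) = coset (\<Inter>x\<in>I. K x) (b v - c b)"
      then have "(a v - c a) - (b v - c b) \<in> K x"
        using coset_eq[OF sK] x by blast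
      then have "0(v := (a v - c a) - (b v - c b)) \<in> H x"
        by (simp add: K_def)
      moreover have "a(v := c a) - b(v := c b) \<in> H x"
        using c[of a] c[of b] ab subgroup_diff[OF sH[OF x]] by blast
      ultimately have "(a(v := c a) - b(v := c b)) + 0(v := (a v - c a) - (b v - c b)) \<in> H x"
        using subgroup_add[OF sH[OF x]] by blast
      moreover have "(a(v := c a) - b(v := c b)) + 0(v := (a v - c a) - (b v - c b)) = a - b"
        by (auto simp: fun_eq_iff)
      ultimately show "a - b \<in> H x"
        by simp
    qed
  qed
  moreover have "is_subgroup (\<Inter>x\<in>I. H x)"
    using sH by (rule subgroup_INT)
  ultimately have "fin_index M (\<Inter>x\<in>I. H x)"
    using fin_index_trans[OF sM] by blast
  moreover have "card J \<le> ulm_d TYPE('a) * card (insert v Y)"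
    using card_Un_le[of J1 J2] J1(2) J2(2) insert.hyps by (simp add: J_def)
  moreover have "J \<subseteq> I"
    using J1 J2 by (simp add: J_def)
  ultimately show ?case
    unfolding M_def by blast
qed


section \<open>Counting traces\<close>

text \<open>Splitting the assignment as a sum turns membership in a subgroup \<open>P\<close> into
  membership of the parameter part in a coset of \<open>P\<close>, one for each point
  \<open>a\<close>.\<close>

lemma assign_append:
  fixes a b :: "'a::ab_group_add list"
  assumes "distinct (x @ y)" "length a = length x"
  shows "assign (x @ y) (a @ b) = assign x a + assign y b"
proof
  fix v
  have none: "map_of (zip vs cs) v = None" if "v \<notin> set vs" for vs :: "nat list" and cs :: "'a list"
    using that by (auto simp: map_of_eq_None_iff dest: set_zip_leftD)
  show "assign (x @ y) (a @ b) v = (assign x a + assign y b) v"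
  proof (cases "v \<in> set x")
    case True
    then have "v \<notin> set y"
      using assms(1) by auto
    then show ?thesis
      using assms(2) none[of y b] True by (simp add: assign_def map_add_def split: option.split)
  next
    case False
    show ?thesis
      using assms(2) by (simp add: none[OF False] assign_def map_add_def split: option.split)
  qed
qed

lemma assign_supported: "assign y b \<in> supported (set y)"
proof -
  have "map_of (zip y b) v = None" if "v \<notin> set y" for v
    using that by (auto simp: map_of_eq_None_iff dest: set_zip_leftD)
  then show ?thesis
    by (auto simp: supported_def assign_def)
qed

text \<open>A trace is recorded by the set \<open>I\<close> of groups having a coset through \<open>b\<close>, by one such coset
  for each group in a small subfamily \<open>B I\<close>, and by one of boundedly many cosets of \<open>\<Inter>I\<close>.\<close>

lemma card_traces_bound:
  assumes fe: "finite_exponent TYPE('a::ab_group_add)" and part: "partitioned \<phi> x y"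
  obtains C where "\<And>S :: 'a list set. S \<subseteq> tuples (length x) \<Longrightarrow> finite S \<Longrightarrow> S \<noteq> {} \<Longrightarrow>
    card (traces \<phi> x y S) \<le> C * card S ^ (ulm_d TYPE('a) * length y)"
proof -
  define D where "D = ulm_d TYPE('a) * length y"
  define V where "V = (supported (set y) :: (nat \<Rightarrow> 'a) set)"
  have dist: "distinct (x @ y)"
    using part by (simp add: partitioned_def)
  then have cardy: "card (set y) = length y"
    by (simp add: distinct_card)
  obtain PP where PP: "finite PP" "\<And>P. P \<in> PP \<Longrightarrow> invariant P"
      and det: "determined PP {e :: nat \<Rightarrow> 'a. sat e \<phi>}"
    using sat_determined[OF fe, of \<phi>] by blast
  have "\<exists>J\<subseteq>I. card J \<le> D \<and> fin_index (V \<inter> \<Inter>J) (\<Inter>I)" if "I \<subseteq> PP" for I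
    using invariant_subfamily[OF fe, of "set y" I "\<lambda>P. P"] that PP finite_subset[OF that PP(1)]
    by (auto simp: D_def V_def cardy)
  then obtain B where B: "\<And>I. I \<subseteq> PP \<Longrightarrow> B I \<subseteq> I" "\<And>I. I \<subseteq> PP \<Longrightarrow> card (B I) \<le> D"
      "\<And>I. I \<subseteq> PP \<Longrightarrow> fin_index (V \<inter> \<Inter>(B I)) (\<Inter>I)"
    by metis
  \<comment> \<open>The number of cosets still to be distinguished once \<open>B I\<close> is fixed;
    it does not depend on \<open>S\<close>.\<close>
  define n where "n I = card (coset (\<Inter>I) ` (V \<inter> \<Inter>(B I)))" for I
  show ?thesis
  proof (rule that[of "\<Sum>I\<in>Pow PP. n I"])
    fix S :: "'a list set"
    assume S: "S \<subseteq> tuples (length x)" "finite S" "S \<noteq> {}"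
    define tr where "tr g = {a \<in> S. sat (assign x a + g) \<phi>}" for g
    define meets where "meets g = {P \<in> PP. \<exists>a\<in>S. assign x a + g \<in> P}" for g
    define G where "G I f = {g \<in> V. meets g = I \<and> (\<forall>P\<in>B I. assign x (f P) + g \<in> P)}" for I f
    define T where "T = (\<Union>I\<in>Pow PP. \<Union>f\<in>B I \<rightarrow>\<^sub>E S. tr ` G I f)"
    have finB: "finite (B I)" if "I \<subseteq> PP" for I
      using B(1)[OF that] that PP(1) by (meson finite_subset)
    have cardG: "card (tr ` G I f) \<le> n I" if I: "I \<subseteq> PP" for I f
    proof (cases "G I f = {}")
      case False
      then obtain g0 where g0: "g0 \<in> G I f"
        by blast
      have sI: "is_subgroup (\<Inter>I)"
        using subgroup_INT[of I "\<lambda>P. P"] PP(2) I invariant_subgroup by auto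
      have sBI: "is_subgroup (V \<inter> \<Inter>(B I))"
        unfolding V_def using subgroup_INT[of "B I" "\<lambda>P. P"] PP(2) I B(1)[OF I]
        by (intro subgroup_Int subgroup_supported) (auto intro: invariant_subgroup)
      have sub: "g - g' \<in> V \<inter> \<Inter>(B I)" if "g \<in> G I f" "g' \<in> G I f" for g g'
      proof -
        have "g - g' \<in> P" if P: "P \<in> B I" for P
        proof -
          have "is_subgroup P"
            using P B(1)[OF I] I PP(2) invariant_subgroup by blast
          then have "(assign x (f P) + g) - (assign x (f P) + g') \<in> P"
            using \<open>g \<in> G I f\<close> \<open>g' \<in> G I f\<close> P by (intro subgroup_diff) (auto simp: G_def)
          then show ?thesis
            by simp
        qed
        moreover have "g - g' \<in> V"
          using that subgroup_diff[OF subgroup_supported] by (auto simp: G_def V_def)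
        ultimately show ?thesis
          by blast
      qed
      \<comment> \<open>For \<open>P\<close> in \<open>I\<close> the difference lies in
        \<open>P\<close>; for the other \<open>P\<close> neither parameter puts any point of
        \<open>S\<close> into \<open>P\<close>. So both give the same memberships in all of
        \<open>PP\<close>.\<close>
      have same: "tr g = tr g'" if g: "g \<in> G I f" "g' \<in> G I f" "g - g' \<in> \<Inter>I" for g g'
      proof -
        have "sat (assign x a + g) \<phi> \<longleftrightarrow> sat (assign x a + g') \<phi>" if a: "a \<in> S" for a
        proof -
          have "assign x a + g \<in> P \<longleftrightarrow> assign x a + g' \<in> P" if P: "P \<in> PP" for P
          proof (cases "P \<in> I")
            case True
            have sP: "is_subgroup P"
              using P PP(2) invariant_subgroup by blast
            have gP: "g - g' \<in> P"
              using g(3) True by blast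
            show ?thesis
              using subgroup_diff[OF sP _ gP, of "assign x a + g"]
                subgroup_add[OF sP _ gP, of "assign x a + g'"] by (auto simp: algebra_simps)
          next
            case False
            then have "P \<notin> meets g" "P \<notin> meets g'"
              using g(1,2) by (simp_all add: G_def)
            then show ?thesis
              using a P unfolding meets_def by blast
          qed
          then have "assign x a + g \<in> {e. sat e \<phi>} \<longleftrightarrow> assign x a + g' \<in> {e. sat e \<phi>}"
            by (intro det[unfolded determined_def, rule_format])
          then show ?thesis
            by simp
        qed
        then show ?thesis
          by (auto simp: tr_def)
      qed
      define s where "s z = (SOME g. g \<in> G I f \<and> tr g = z)" for z
      have s: "s z \<in> G I f \<and> tr (s z) = z" if "z \<in> tr ` G I f" for z
      proof -
        have "\<exists>g. g \<in> G I f \<and> tr g = z"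
          using that by blast
        then show ?thesis
          unfolding s_def by (rule someI_ex)
      qed
      have "inj_on (\<lambda>z. coset (\<Inter>I) (s z - g0)) (tr ` G I f)"
      proof (rule inj_onI)
        fix z z' assume z: "z \<in> tr ` G I f" "z' \<in> tr ` G I f"
          and "coset (\<Inter>I) (s z - g0) = coset (\<Inter>I) (s z' - g0)"
        then have "(s z - g0) - (s z' - g0) \<in> \<Inter>I"
          using coset_eq[OF sI] by blast
        then have "s z - s z' \<in> \<Inter>I"
          by simp
        then show "z = z'"
          using same[of "s z" "s z'"] s[OF z(1)] s[OF z(2)] by simp
      qed
      moreover have "(\<lambda>z. coset (\<Inter>I) (s z - g0)) ` tr ` G I f \<subseteq> coset (\<Inter>I) ` (V \<inter> \<Inter>(B I))"
        using sub[OF _ g0] s by blast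
      moreover have "finite (coset (\<Inter>I) ` (V \<inter> \<Inter>(B I)))"
        using B(3)[OF I] by (simp add: fin_index_def)
      ultimately show ?thesis
        unfolding n_def by (rule card_inj_on_le)
    qed simp
    have "traces \<phi> x y S \<subseteq> T"
    proof
      fix z assume "z \<in> traces \<phi> x y S"
      then obtain b where b: "z = S \<inter> instance_set \<phi> x y b"
        unfolding traces_def by blast
      define g where "g = assign y b"
      have "sat (assign (x @ y) (a @ b)) \<phi> \<longleftrightarrow> sat (assign x a + g) \<phi>" if "a \<in> S" for a
        using assign_append[OF dist, of a b] that S(1) by (auto simp: g_def tuples_def)
      then have z: "z = tr g"
        using S(1) by (auto simp: b instance_set_def tr_def)
      define I where "I = meets g"
      have I: "I \<subseteq> PP"
        by (auto simp: I_def meets_def)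
      \<comment> \<open>The restriction to \<open>B I\<close> makes \<open>f\<close> a member of a
        finite function space with \<open>card S ^ card (B I)\<close> elements.\<close>
      define f where "f = (\<lambda>P\<in>B I. SOME a. a \<in> S \<and> assign x a + g \<in> P)"
      have f: "f P \<in> S \<and> assign x (f P) + g \<in> P" if P: "P \<in> B I" for P
      proof -
        have "\<exists>a. a \<in> S \<and> assign x a + g \<in> P"
          using P B(1)[OF I] by (auto simp: I_def meets_def)
        from someI_ex[OF this] show ?thesis
          using P by (simp add: f_def)
      qed
      have "f \<in> B I \<rightarrow>\<^sub>E S"
        using f by (auto simp: f_def)
      moreover have "g \<in> G I f"
        using f assign_supported by (auto simp: G_def V_def g_def I_def)
      ultimately show "z \<in> T"
        unfolding T_def z using I by blast
    qed
    moreover have "finite T"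
    proof (rule finite_subset)
      show "T \<subseteq> Pow S"
        by (auto simp: T_def tr_def)
    qed (use S in simp)
    ultimately have "card (traces \<phi> x y S) \<le> card T"
      by (intro card_mono)
    also have "\<dots> \<le> (\<Sum>I\<in>Pow PP. card (\<Union>f\<in>B I \<rightarrow>\<^sub>E S. tr ` G I f))"
      unfolding T_def using PP(1) by (intro card_UN_le) simp
    also have "\<dots> \<le> (\<Sum>I\<in>Pow PP. n I * card S ^ D)"
    proof (rule sum_mono)
      fix I assume "I \<in> Pow PP"
      then have I: "I \<subseteq> PP" by simp
      have fin: "finite (B I \<rightarrow>\<^sub>E S)"
        using finB[OF I] S(2) by (intro finite_PiE) auto
      have "card (\<Union>f\<in>B I \<rightarrow>\<^sub>E S. tr ` G I f) \<le> (\<Sum>f\<in>B I \<rightarrow>\<^sub>E S. card (tr ` G I f))"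
        by (rule card_UN_le[OF fin])
      also have "\<dots> \<le> (\<Sum>f\<in>B I \<rightarrow>\<^sub>E S. n I)"
        by (intro sum_mono cardG I)
      also have "\<dots> = n I * card S ^ card (B I)"
        using finB[OF I] by (simp add: card_PiE)
      \<comment> \<open>Nonemptiness of \<open>S\<close> enters here: raising the exponent to
        \<open>D\<close> needs a base of at least 1.\<close>
      also have "\<dots> \<le> n I * card S ^ D"
        using B(2)[OF I] S(2,3) by (intro mult_left_mono power_increasing) (auto simp: Suc_le_eq card_gt_0_iff)
      finally show "card (\<Union>f\<in>B I \<rightarrow>\<^sub>E S. tr ` G I f) \<le> n I * card S ^ D" .
    qed
    finally show "card (traces \<phi> x y S)
        \<le> (\<Sum>I\<in>Pow PP. n I) * card S ^ (ulm_d TYPE('a) * length y)"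
      by (simp add: sum_distrib_right D_def)
  qed
qed

section \<open>From the trace bound to VC density\<close>

theorem theorem1p2:
  fixes \<phi> :: fm and x y :: "nat list"
  assumes "infinite (UNIV :: 'a::ab_group_add set)"
    and "finite_exponent TYPE('a)"
    and "partitioned \<phi> x y"
  shows "vc_density TYPE('a) \<phi> x y \<le> ereal (real (ulm_d TYPE('a) * length y))"
proof -
  define D where "D = ulm_d TYPE('a) * length y"
  define f where "f = shatter TYPE('a) \<phi> x y"
  obtain C where "\<And>S :: 'a list set. S \<subseteq> tuples (length x) \<Longrightarrow> finite S \<Longrightarrow> S \<noteq> {} \<Longrightarrow>
      card (traces \<phi> x y S) \<le> C * card S ^ (ulm_d TYPE('a) * length y)"
    by (rule card_traces_bound[OF assms(2,3)]) (rule that)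
  note C = this[folded D_def]
  have bound: "f t \<le> C * t ^ D" if t: "t > 0" for t
  proof -
    let ?SS = "{S :: 'a list set. S \<subseteq> tuples (length x) \<and> finite S \<and> card S = t}"
    show ?thesis
    proof (cases "?SS = {}")
      \<comment> \<open>There are no sets of this size, and the supremum of the empty set of
        naturals is 0.\<close>
      case True
      then show ?thesis
        unfolding f_def shatter_def True by simp
    next
      case False
      moreover have "card (traces \<phi> x y S) \<le> C * t ^ D" if "S \<in> ?SS" for S
        using C[of S] that t by fastforce
      ultimately show ?thesis
        unfolding f_def shatter_def by (rule cSUP_least)
    qed
  qed
  have big: "(\<lambda>t. real (f t)) \<in> O(\<lambda>t. real t powr real D)"
  proof (rule bigoI[of _ "real C"])
    show "\<forall>\<^sub>F t in sequentially. norm (real (f t)) \<le> real C * norm (real t powr real D)"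
      using eventually_gt_at_top[of 0]
    proof eventually_elim
      case (elim t)
      have "real (f t) \<le> real (C * t ^ D)"
        using bound[OF elim] by (simp only: of_nat_le_iff)
      then show ?case
        using elim by (simp add: powr_realpow)
    qed
  qed
  \<comment> \<open>The polynomial bound excludes growth \<open>2 ^ t\<close>, so the density is
    given by the infimum.\<close>
  have "\<not> (\<forall>t. f t = 2 ^ t)"
  proof
    assume f2: "\<forall>t. f t = 2 ^ t"
    have "(\<lambda>t. 2 ^ t :: real) \<in> O(\<lambda>t. real t powr real D)"
      using big f2 by simp
    moreover have "(\<lambda>t. real t powr real D) \<in> o(\<lambda>t. 2 ^ t)"
      by real_asymp
    ultimately have "(\<lambda>t. 2 ^ t :: real) \<in> o(\<lambda>t. 2 ^ t)"
      by (rule landau_o.big_small_trans)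
    then show False
      by (simp add: landau_o.small_refl_iff)
  qed
  then have "vc_density TYPE('a) \<phi> x y = (INF r\<in>{r::real. 0 \<le> r \<and>
      (\<lambda>t. real (f t)) \<in> O(\<lambda>t. real t powr r)}. ereal r)"
    unfolding vc_density_def f_def by (rule if_not_P)
  also have "\<dots> \<le> ereal (real D)"
    by (rule INF_lower) (use big in simp)
  finally show ?thesis
    by (simp add: D_def)
qed

end
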